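(* For every $k\in\mathbb{N}$ there exists a snark $G_k$ with $|V(G_k)|=90k$ and $o(G_k)\ge 6k$.
   Context: Here $\mathbb{N}$ denotes the positive integers. A snark is a cubic, cyclically 4-edge-connected graph that has no 3-edge-coloring. (Cyclically 4-edge-connected: no set of fewer than 4 edges separates the graph so that at least two of the resulting components contain cycles.) The oddness $o(H)$ of a bridgeless cubic graph $H$ is the minimum number of odd components (cycles of odd length) in any 2-factor of $H$. *)

theory Defs
  imports Main
begin

text \<open>
  Finite simple graphs suffice here, even if graphs may have loops or parallel edges: in a
  cyclically 4-edge-connected cubic graph with at least four vertices, a loop or a pair of
  parallel edges would be cut off from another cycle by at most two edges.
\<close>

record 'a ugraph =
  verts :: "'a set"
  edges :: "'a set set"

definition simple_graph :: "'a ugraph \<Rightarrow> bool" where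
  "simple_graph G \<longleftrightarrow> finite (verts G) \<and> (\<forall>e \<in> edges G. e \<subseteq> verts G \<and> card e = 2)"

definition degree :: "'a ugraph \<Rightarrow> 'a \<Rightarrow> nat" where
  "degree G v = card {e \<in> edges G. v \<in> e}"

definition regular :: "nat \<Rightarrow> 'a ugraph \<Rightarrow> bool" where
  "regular d G \<longleftrightarrow> (\<forall>v \<in> verts G. degree G v = d)"

abbreviation cubic :: "'a ugraph \<Rightarrow> bool" where
  "cubic \<equiv> regular 3"

definition adj :: "'a ugraph \<Rightarrow> ('a \<times> 'a) set" where
  "adj G = {(u, v). {u, v} \<in> edges G}"

text \<open>Connected components are represented by their vertex sets.\<close>

definition components :: "'a ugraph \<Rightarrow> 'a set set" where
  "components G = (\<lambda>v. (adj G)\<^sup>* `` {v}) ` verts G"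

definition is_cycle :: "'a ugraph \<Rightarrow> 'a list \<Rightarrow> bool" where
  "is_cycle G p \<longleftrightarrow> 3 \<le> length p \<and> distinct p \<and> set p \<subseteq> verts G \<and>
     (\<forall>i < length p. {p ! i, p ! (Suc i mod length p)} \<in> edges G)"

definition delete_edges :: "'a ugraph \<Rightarrow> 'a set set \<Rightarrow> 'a ugraph" where
  "delete_edges G S = G\<lparr>edges := edges G - S\<rparr>"

text \<open>
  The edge set \<open>S\<close> may be empty, so connectedness is not required separately: each component of
  a finite cubic graph contains a cycle.
\<close>

definition cyclically_edge_connected :: "nat \<Rightarrow> 'a ugraph \<Rightarrow> bool" where
  "cyclically_edge_connected m G \<longleftrightarrow>
     \<not> (\<exists>S \<subseteq> edges G. card S < m \<and>
         (\<exists>C \<in> components (delete_edges G S). \<exists>D \<in> components (delete_edges G S). C \<noteq> D \<and>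
            (\<exists>p. is_cycle (delete_edges G S) p \<and> set p \<subseteq> C) \<and>
            (\<exists>q. is_cycle (delete_edges G S) q \<and> set q \<subseteq> D)))"

definition edge_coloring :: "nat \<Rightarrow> 'a ugraph \<Rightarrow> ('a set \<Rightarrow> nat) \<Rightarrow> bool" where
  "edge_coloring m G c \<longleftrightarrow> (\<forall>e \<in> edges G. c e < m) \<and>
     (\<forall>e \<in> edges G. \<forall>f \<in> edges G. e \<noteq> f \<and> e \<inter> f \<noteq> {} \<longrightarrow> c e \<noteq> c f)"

definition snark :: "'a ugraph \<Rightarrow> bool" where
  "snark G \<longleftrightarrow> simple_graph G \<and> cubic G \<and> cyclically_edge_connected 4 G \<and>
     \<not> (\<exists>c. edge_coloring 3 G c)"

definition two_factor :: "'a ugraph \<Rightarrow> 'a ugraph \<Rightarrow> bool" where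
  "two_factor G F \<longleftrightarrow> verts F = verts G \<and> edges F \<subseteq> edges G \<and> regular 2 F"

text \<open>
  The components of a 2-factor are cycles, so the length of a component is its number of vertices.
\<close>

definition odd_components :: "'a ugraph \<Rightarrow> 'a set set" where
  "odd_components F = {C \<in> components F. odd (card C)}"

text \<open>
  The minimum is over a nonempty set for every bridgeless cubic graph, by Petersen's theorem.
  For a graph without a 2-factor, the value is \<open>Inf {} = 0\<close>, so a positive lower bound on the
  oddness is never vacuous.
\<close>

definition oddness :: "'a ugraph \<Rightarrow> nat" where
  "oddness G = Inf {card (odd_components F) | F. two_factor G F}"

end

theory Submission
  imports Defs
begin

text \<open>
  Deleting two adjacent vertices from the Petersen graph leaves a fragment with two pairs of
  dangling edges, and since the Petersen graph has no 3-edge-coloring, both edges of a pair always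
  get the same color. Arrange five fragments in a ring, joining a pair of each to a pair of the
  next by one plain edge and one subdivided edge. The subdivision vertex makes one of the two
  pairs unequal, so two consecutive fragments with the vertex between them (a block) cannot be
  3-edge-colored. Given a 2-factor, color its complement with one color and alternate the two
  others along the cycles; in an odd cycle this fails only at one vertex, of our choice. Hence each
  block contains a whole odd cycle. Each vertex of a ring lies in at most two of its five blocks,
  so there are at least three odd cycles in each ring. The graph consists of \<open>2k\<close> rings of
  45 vertices; the third edges at the subdivision vertices join the rings in a cyclic order,
  alternately by three and by two edges.
\<close>

section \<open>Edge colorings from 2-factors\<close>

lemma degree_eq_card_neighbours:
  assumes "simple_graph G"
  shows "degree G v = card {w. {v, w} \<in> edges G}"
proof -
  have "{e \<in> edges G. v \<in> e} = (\<lambda>w. {v, w}) ` {w. {v, w} \<in> edges G}"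
  proof (intro set_eqI iffI)
    fix e assume e: "e \<in> {e \<in> edges G. v \<in> e}"
    then have "card e = 2" using assms by (auto simp: simple_graph_def)
    then obtain a b where "e = {a, b}" by (auto simp: card_2_iff)
    with e have "\<exists>w. e = {v, w}" by auto
    with e show "e \<in> (\<lambda>w. {v, w}) ` {w. {v, w} \<in> edges G}" by auto
  qed auto
  moreover have "inj_on (\<lambda>w. {v, w}) {w. {v, w} \<in> edges G}"
    by (auto simp: inj_on_def doubleton_eq_iff)
  ultimately show ?thesis unfolding degree_def by (simp add: card_image)
qed

lemma two_regular_neighbours:
  assumes "simple_graph F" "regular 2 F" "{v, a} \<in> edges F" "{v, b} \<in> edges F" "a \<noteq> b"
  shows "{w. {v, w} \<in> edges F} = {a, b}"
proof -
  have "v \<in> verts F" using assms(1,3) by (auto simp: simple_graph_def)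
  then have c: "card {w. {v, w} \<in> edges F} = 2"
    using assms(1,2) degree_eq_card_neighbours[of F v] by (auto simp: regular_def)
  then have "finite {w. {v, w} \<in> edges F}" by (intro card_ge_0_finite) simp
  then show ?thesis using assms(3-5) c by (intro card_subset_eq[symmetric]) auto
qed

text \<open>A longest path starting at \<open>x\<close> runs through the whole cycle containing \<open>x\<close>.\<close>

lemma two_regular_component_cycle:
  assumes F: "simple_graph F" "regular 2 F" and x: "x \<in> verts F"
  shows "\<exists>p. distinct p \<and> 3 \<le> length p \<and> p ! 0 = x \<and> set p = (adj F)\<^sup>* `` {x} \<and>
    (\<forall>i. Suc i < length p \<longrightarrow> {p ! i, p ! Suc i} \<in> edges F) \<and>
    {p ! (length p - 1), p ! 0} \<in> edges F"
proof -
  define P where "P p \<longleftrightarrow> distinct p \<and> 0 < length p \<and> p ! 0 = x \<and> set p \<subseteq> verts F \<and>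
    (\<forall>i. Suc i < length p \<longrightarrow> {p ! i, p ! Suc i} \<in> edges F)" for p
  have fin: "finite (verts F)" and sub: "\<And>u v. {u, v} \<in> edges F \<Longrightarrow> u \<in> verts F \<and> v \<in> verts F"
    and irr: "\<And>u. {u} \<notin> edges F"
    using F(1) by (auto simp: simple_graph_def)
  have "P [x]" using x by (auto simp: P_def)
  moreover have "\<forall>p. P p \<longrightarrow> length p < Suc (card (verts F))"
    using fin by (auto simp: P_def less_Suc_eq_le card_mono simp flip: distinct_card)
  ultimately obtain p where p: "P p" and max: "\<And>q. P q \<Longrightarrow> length q \<le> length p"
    using ex_has_greatest_nat[of P "[x]" length "Suc (card (verts F))"] by auto
  define L where "L = length p"
  have L: "0 < L" and dist: "distinct p" and p0: "p ! 0 = x" and pV: "set p \<subseteq> verts F"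
    and pe: "\<And>i. Suc i < L \<Longrightarrow> {p ! i, p ! Suc i} \<in> edges F"
    using p by (auto simp: P_def L_def)
  have idx: "p ! i = p ! j \<longleftrightarrow> i = j" if "i < L" "j < L" for i j
    using that dist by (simp add: nth_eq_iff_index_eq L_def)
  have setp: "v \<in> set p \<longleftrightarrow> (\<exists>i<L. v = p ! i)" for v
    by (auto simp: in_set_conv_nth L_def)
  define l where "l = p ! (L - 1)"
  have closed: "w \<in> set p" if "{l, w} \<in> edges F" for w
  proof (rule ccontr)
    assume "w \<notin> set p"
    then have "P (p @ [w])"
      using p that sub[OF that] unfolding P_def l_def L_def
      by (auto simp: nth_append less_Suc_eq) (metis diff_Suc_1' )
    from max[OF this] show False by simp
  qed
  have lV: "l \<in> verts F" using pV L by (auto simp: l_def L_def)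
  then have "card {w. {l, w} \<in> edges F} = 2"
    using F degree_eq_card_neighbours[of F l] by (auto simp: regular_def)
  then obtain y z where yz: "{w. {l, w} \<in> edges F} = {y, z}" "y \<noteq> z" by (auto simp: card_2_iff)
  \<comment> \<open>By maximality both neighbours of the last vertex \<open>l\<close> lie on the
    path. At most one of them is the predecessor of \<open>l\<close>, at index \<open>L - 2\<close>,
    so there is another one.\<close>
  have "\<exists>a. a < L \<and> {l, p ! a} \<in> edges F \<and> Suc (Suc a) \<noteq> L"
  proof -
    have "y \<in> set p" "z \<in> set p" using yz closed by blast+
    then obtain a b where ab: "a < L" "b < L" "y = p ! a" "z = p ! b"
      by (auto simp: in_set_conv_nth L_def)
    with yz have "a \<noteq> b" by auto
    then have "Suc (Suc a) \<noteq> L \<or> Suc (Suc b) \<noteq> L" by linarith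
    then show ?thesis using ab yz by blast
  qed
  then obtain a where a: "a < L" "{l, p ! a} \<in> edges F" "Suc (Suc a) \<noteq> L" by blast
  have "a \<noteq> L - 1" using a(2) irr by (auto simp: l_def)
  with a have aL: "Suc (Suc a) < L" by linarith
  \<comment> \<open>Otherwise \<open>p ! a\<close> would have three neighbours: the two next to it
    on the path and \<open>l\<close>.\<close>
  have "a = 0"
  proof (rule ccontr)
    assume "a \<noteq> 0"
    then obtain b where b: "a = Suc b" by (cases a) auto
    have "{p ! a, p ! b} \<in> edges F" "{p ! a, p ! Suc a} \<in> edges F" "{p ! a, l} \<in> edges F"
      using pe[of b] pe[of a] a aL b by (auto simp: insert_commute)
    moreover have "p ! b \<noteq> p ! Suc a" using idx b aL by auto
    ultimately have "l \<in> {p ! b, p ! Suc a}"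
      using two_regular_neighbours[OF F, of "p ! a" "p ! b" "p ! Suc a"] by blast
    then show False using idx[of "L - 1" b] idx[of "L - 1" "Suc a"] b aL by (auto simp: l_def)
  qed
  with aL a have L3: "3 \<le> L" and pl: "{p ! (L - 1), p ! 0} \<in> edges F" by (auto simp: l_def)
  have mem: "p ! i \<in> set p" if "i < L" for i using that by (simp add: L_def)
  have cl: "w \<in> set p" if "v \<in> set p" "{v, w} \<in> edges F" for v w
  proof -
    from that(1) obtain i where i: "i < L" "v = p ! i" unfolding setp by blast
    consider "i = 0" | "i = L - 1" | "0 < i" "Suc i < L" using i(1) by linarith
    then show ?thesis
    proof cases
      case 1
      have "p ! 1 \<noteq> p ! (L - 1)" using idx L3 by auto
      moreover have "{v, p ! 1} \<in> edges F" "{v, p ! (L - 1)} \<in> edges F"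
        using pe[of 0] pl i(2) 1 L3 by (simp_all add: insert_commute)
      ultimately have "w \<in> {p ! 1, p ! (L - 1)}"
        using two_regular_neighbours[OF F, of v "p ! 1" "p ! (L - 1)"] that(2) by blast
      then show ?thesis using mem[of 1] mem[of "L - 1"] L3 by auto
    next
      case 2
      then show ?thesis using that(2) i(2) closed l_def by simp
    next
      case 3
      then obtain j where j: "i = Suc j" using gr0_implies_Suc by blast
      have "p ! j \<noteq> p ! Suc i" using idx 3 j by auto
      moreover have "{v, p ! j} \<in> edges F" "{v, p ! Suc i} \<in> edges F"
        using pe[of j] pe[of i] i(2) 3 j by (simp_all add: insert_commute)
      ultimately have "w \<in> {p ! j, p ! Suc i}"
        using two_regular_neighbours[OF F, of v "p ! j" "p ! Suc i"] that(2) by blast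
      then show ?thesis using mem[of j] mem[of "Suc i"] 3 j by auto
    qed
  qed
  have "set p = (adj F)\<^sup>* `` {x}"
  proof
    show "(adj F)\<^sup>* `` {x} \<subseteq> set p"
    proof
      fix w assume "w \<in> (adj F)\<^sup>* `` {x}"
      then have "(x, w) \<in> (adj F)\<^sup>*" by simp
      then show "w \<in> set p"
      proof (induction rule: rtrancl_induct)
        case base
        then show ?case using p0 L by (metis L_def nth_mem)
      next
        case (step y z)
        then show ?case using cl[of y z] by (auto simp: adj_def)
      qed
    qed
    have "(x, p ! i) \<in> (adj F)\<^sup>*" if "i < L" for i
      using that
    proof (induction i)
      case 0
      then show ?case using p0 by simp
    next
      case (Suc i)
      then show ?case using pe[of i] by (auto simp: adj_def intro: rtrancl_into_rtrancl)
    qed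
    then show "set p \<subseteq> (adj F)\<^sup>* `` {x}" by (auto simp: in_set_conv_nth L_def)
  qed
  then show ?thesis
    using dist L3 p0 pe pl by (intro exI[of _ p] conjI allI impI) (simp_all add: L_def)
qed

text \<open>The edges are numbered along the cycle from \<open>x\<close> and colored by the parity
  of their number. Only the first and the last edge, which meet at \<open>x\<close>, can clash, and
  they do so only if the length is odd.\<close>

lemma two_regular_component_coloring:
  assumes F: "simple_graph F" "regular 2 F" and x: "x \<in> verts F"
  shows "\<exists>f :: 'a set \<Rightarrow> nat. (\<forall>e. f e < 2) \<and>
    (\<forall>v \<in> (adj F)\<^sup>* `` {x}. (v = x \<longrightarrow> even (card ((adj F)\<^sup>* `` {x}))) \<longrightarrow>
      (\<forall>e \<in> edges F. \<forall>e' \<in> edges F. v \<in> e \<and> v \<in> e' \<and> e \<noteq> e' \<longrightarrow> f e \<noteq> f e'))"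
proof -
  obtain p where dist: "distinct p" and L3: "3 \<le> length p" and p0: "p ! 0 = x"
    and set: "set p = (adj F)\<^sup>* `` {x}"
    and pe: "\<forall>i. Suc i < length p \<longrightarrow> {p ! i, p ! Suc i} \<in> edges F"
    and pl: "{p ! (length p - 1), p ! 0} \<in> edges F"
    using two_regular_component_cycle[OF assms] by (elim exE conjE) (rule that; assumption)
  define L where "L = length p"
  have L: "3 \<le> L" using L3 by (simp add: L_def)
  have pe: "{p ! i, p ! Suc i} \<in> edges F" if "Suc i < L" for i using pe that by (simp add: L_def)
  have pl: "{p ! (L - 1), p ! 0} \<in> edges F" using pl by (simp add: L_def)
  have idx: "p ! i = p ! j \<longleftrightarrow> i = j" if "i < L" "j < L" for i j
    using that dist by (simp add: nth_eq_iff_index_eq L_def)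
  have setp: "v \<in> set p \<longleftrightarrow> (\<exists>i<L. v = p ! i)" for v
    by (auto simp: in_set_conv_nth L_def)
  \<comment> \<open>The number of a cycle edge is the least index of its ends; the closing edge,
    whose least index is 0, gets \<open>L - 1\<close> instead.\<close>
  define f :: "'a set \<Rightarrow> nat" where
    "f e = (if e = {p ! (L - 1), p ! 0} then L - 1 else (LEAST i. p ! i \<in> e)) mod 2" for e
  have f1: "f {p ! i, p ! Suc i} = i mod 2" if "Suc i < L" for i
  proof -
    have "{p ! i, p ! Suc i} \<noteq> {p ! (L - 1), p ! 0}"
    proof
      assume "{p ! i, p ! Suc i} = {p ! (L - 1), p ! 0}"
      then have "p ! Suc i = p ! 0 \<or> p ! i = p ! 0 \<and> p ! Suc i = p ! (L - 1)"
        by (simp add: doubleton_eq_iff) blast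
      moreover have "p ! Suc i \<noteq> p ! 0" using that L idx[of "Suc i" 0] by simp
      moreover have "i = 0" if "p ! i = p ! 0" using that \<open>Suc i < L\<close> idx[of i 0] by simp
      moreover have "Suc i = L - 1" if "p ! Suc i = p ! (L - 1)"
        using that \<open>Suc i < L\<close> idx[of "Suc i" "L - 1"] by simp
      ultimately show False using L by linarith
    qed
    moreover have "(LEAST j. p ! j \<in> {p ! i, p ! Suc i}) = i"
    proof (rule Least_equality)
      fix j assume j: "p ! j \<in> {p ! i, p ! Suc i}"
      show "i \<le> j"
      proof (rule ccontr)
        assume "\<not> i \<le> j"
        then show False using j that idx[of j i] idx[of j "Suc i"] by auto
      qed
    qed simp
    ultimately show ?thesis by (simp add: f_def)
  qed
  have f2: "f {p ! (L - 1), p ! 0} = (L - 1) mod 2" by (simp add: f_def)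
  have edge: "e = {v, a} \<or> e = {v, b}"
    if "{v, a} \<in> edges F" "{v, b} \<in> edges F" "a \<noteq> b" "e \<in> edges F" "v \<in> e" for v a b e
  proof -
    have "card e = 2" using F(1) that(4) by (auto simp: simple_graph_def)
    with \<open>v \<in> e\<close> obtain w where "e = {v, w}" by (auto simp: card_2_iff)
    moreover from this have "w \<in> {w. {v, w} \<in> edges F}" using that(4) by simp
    ultimately show ?thesis unfolding two_regular_neighbours[OF F that(1-3)] by auto
  qed
  have two: "f e \<noteq> f e'"
    if "{v, a} \<in> edges F" "{v, b} \<in> edges F" "a \<noteq> b" "f {v, a} \<noteq> f {v, b}"
      "e \<in> edges F" "e' \<in> edges F" "v \<in> e" "v \<in> e'" "e \<noteq> e'" for v a b e e'
    using edge[OF that(1-3) that(5,7)] edge[OF that(1-3) that(6,8)] that(4,9) by auto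
  have pe': "{p ! Suc i, p ! i} \<in> edges F" if "Suc i < L" for i
    using pe[OF that] by (simp add: insert_commute)
  have pl': "{p ! 0, p ! (L - 1)} \<in> edges F"
    using pl by (simp add: insert_commute)
  have f1': "f {p ! Suc i, p ! i} = i mod 2" if "Suc i < L" for i
    using f1[OF that] by (simp add: insert_commute)
  have f2': "f {p ! 0, p ! (L - 1)} = (L - 1) mod 2"
    using f2 by (simp add: insert_commute)
  have Suc_mod: "n mod 2 \<noteq> Suc n mod 2" for n :: nat by presburger
  have main: "f e \<noteq> f e'"
    if v: "v \<in> set p" "v = x \<longrightarrow> even L"
      and e: "e \<in> edges F" "e' \<in> edges F" "v \<in> e" "v \<in> e'" "e \<noteq> e'" for v e e'
  proof -
    from v(1) obtain i where i: "i < L" "v = p ! i" unfolding setp by blast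
    consider "i = 0" | j where "i = Suc j" "i = L - 1" | j where "i = Suc j" "Suc i < L"
      using i(1) gr0_implies_Suc[of i] by (metis Suc_lessI diff_Suc_1 gr0I)
    then show ?thesis
    proof cases
      case 1
      then have "even L" using v(2) i(2) p0 by simp
      then have "0 mod 2 \<noteq> (L - 1) mod 2" using L by (simp add: mod_eq_0_iff_dvd)
      then have "f {p ! 0, p ! Suc 0} \<noteq> f {p ! 0, p ! (L - 1)}"
        using f1[of 0] L unfolding f2' by simp
      moreover have "p ! Suc 0 \<noteq> p ! (L - 1)" using idx L by simp
      ultimately show ?thesis
        using two[OF pe[of 0] pl' _ _ e(1,2)] e(3-5) L i(2) 1 by simp
    next
      case 2
      then have "{p ! Suc j, p ! 0} \<in> edges F" "f {p ! Suc j, p ! 0} = Suc j mod 2"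
        using pl f2 by simp_all
      moreover have "f {p ! Suc j, p ! j} = j mod 2"
        using f1'[of j] L 2 by simp
      moreover have "p ! j \<noteq> p ! 0" using idx[of j 0] L 2 by simp
      ultimately show ?thesis
        using two[OF pe'[of j] _ _ _ e(1,2), of "p ! 0"] e(3-5) L i 2 Suc_mod[of j] by simp
    next
      case 3
      have "f {p ! Suc j, p ! j} \<noteq> f {p ! i, p ! Suc i}"
        using f1'[of j] f1[of i] 3 Suc_mod[of j] by simp
      moreover have "p ! j \<noteq> p ! Suc i" using idx[of j "Suc i"] 3 by simp
      ultimately show ?thesis
        using two[OF pe'[of j] pe[of "Suc j"] _ _ e(1,2)] e(3-5) i 3 by simp
    qed
  qed
  have "card ((adj F)\<^sup>* `` {x}) = L" using dist set by (metis L_def distinct_card)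
  then show ?thesis
    using main set by (intro exI[of _ f]) (auto simp: f_def)
qed

section \<open>Gluing the colorings of the components\<close>

lemma sym_adj: "sym (adj G)"
  by (auto simp: sym_def adj_def insert_commute)

lemma reachable_eq:
  assumes "(u, v) \<in> (adj G)\<^sup>*"
  shows "(adj G)\<^sup>* `` {u} = (adj G)\<^sup>* `` {v}"
proof -
  have "(v, u) \<in> (adj G)\<^sup>*" using assms sym_adj[of G] by (metis sym_rtrancl symD)
  with assms show ?thesis by (auto intro: rtrancl_trans)
qed

lemma component_eq:
  assumes "C \<in> components G" "v \<in> C"
  shows "C = (adj G)\<^sup>* `` {v}"
  using assms reachable_eq by (fastforce simp: components_def)

lemma component_subset:
  assumes "simple_graph G" "C \<in> components G"
  shows "C \<subseteq> verts G"
proof -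
  have "w \<in> verts G" if "(u, w) \<in> (adj G)\<^sup>*" "u \<in> verts G" for u w
    using that
    by (induction rule: rtrancl_induct) (use assms(1) in \<open>auto simp: adj_def simple_graph_def\<close>)
  then show ?thesis using assms(2) by (auto simp: components_def)
qed

text \<open>\<open>W\<close> is where the coloring has to be proper. An odd component has a vertex
  outside \<open>W\<close>; the numbering of its cycle starts there, which puts the clash
  there.\<close>

lemma component_coloring:
  assumes F: "simple_graph F" "regular 2 F" and C: "C \<in> components F"
    and W: "odd (card C) \<Longrightarrow> \<not> C \<subseteq> W"
  shows "\<exists>f :: 'a set \<Rightarrow> nat. (\<forall>e. f e < 2) \<and>
    (\<forall>v \<in> C \<inter> W. \<forall>e \<in> edges F. \<forall>e' \<in> edges F. v \<in> e \<and> v \<in> e' \<and> e \<noteq> e' \<longrightarrow> f e \<noteq> f e')"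
proof -
  obtain v where v: "v \<in> verts F" "C = (adj F)\<^sup>* `` {v}"
    using C by (auto simp: components_def)
  then have "v \<in> C" by simp
  have "\<exists>x\<in>C. even (card C) \<or> x \<notin> W" using W \<open>v \<in> C\<close> by blast
  then obtain x where x: "x \<in> C" "even (card C) \<or> x \<notin> W" by blast
  have "x \<in> verts F" using x(1) component_subset[OF F(1) C] by blast
  from two_regular_component_coloring[OF F this] obtain f :: "'a set \<Rightarrow> nat" where
    f: "\<forall>e. f e < 2" "\<forall>v \<in> C. (v = x \<longrightarrow> even (card C)) \<longrightarrow>
      (\<forall>e \<in> edges F. \<forall>e' \<in> edges F. v \<in> e \<and> v \<in> e' \<and> e \<noteq> e' \<longrightarrow> f e \<noteq> f e')"
    unfolding component_eq[OF C x(1), symmetric] by (elim exE conjE) (rule that; assumption)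
  have "f e \<noteq> f e'"
    if "v \<in> C \<inter> W" "e \<in> edges F" "e' \<in> edges F" "v \<in> e \<and> v \<in> e' \<and> e \<noteq> e'" for v e e'
    using f(2)[rule_format, of v e e'] that x(2) by auto
  with f(1) show ?thesis by (intro exI[of _ f] conjI ballI impI) simp_all
qed

text \<open>Each component is colored separately by 0 and 1, and all edges outside \<open>F\<close>
  get 2. This is consistent because edges of \<open>F\<close> that meet lie in the same component
  and because a cubic graph has just one edge outside \<open>F\<close> at each vertex.\<close>

lemma two_factor_coloring:
  fixes G F :: "'a ugraph"
  assumes G: "simple_graph G" "cubic G" and F: "two_factor G F"
    and W: "W \<subseteq> verts G" "\<And>C. C \<in> odd_components F \<Longrightarrow> \<not> C \<subseteq> W"
  shows "\<exists>c :: 'a set \<Rightarrow> nat. (\<forall>e. c e < 3) \<and>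
    (\<forall>v \<in> W. \<forall>e \<in> edges G. \<forall>e' \<in> edges G. v \<in> e \<and> v \<in> e' \<and> e \<noteq> e' \<longrightarrow> c e \<noteq> c e')"
proof -
  have F': "verts F = verts G" "edges F \<subseteq> edges G" "regular 2 F" "simple_graph F"
    using F G by (auto simp: two_factor_def simple_graph_def)
  define P where "P C f \<longleftrightarrow> (\<forall>e. f e < 2) \<and>
    (\<forall>v \<in> C \<inter> W. \<forall>e \<in> edges F. \<forall>e' \<in> edges F. v \<in> e \<and> v \<in> e' \<and> e \<noteq> e' \<longrightarrow> f e \<noteq> f e')"
    for C and f :: "'a set \<Rightarrow> nat"
  have "\<forall>C \<in> components F. \<exists>f. P C f"
    unfolding P_def
  proof
    fix C assume C: "C \<in> components F"
    then show "\<exists>f :: 'a set \<Rightarrow> nat. (\<forall>e. f e < 2) \<and>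
    (\<forall>v \<in> C \<inter> W. \<forall>e \<in> edges F. \<forall>e' \<in> edges F. v \<in> e \<and> v \<in> e' \<and> e \<noteq> e' \<longrightarrow> f e \<noteq> f e')"
      by (intro component_coloring[OF F'(4,3)] W(2)) (simp_all add: odd_components_def)
  qed
  then obtain ff where ff: "\<And>C. C \<in> components F \<Longrightarrow> P C (ff C)" by (metis bchoice)
  \<comment> \<open>The component containing an edge \<open>e\<close> of \<open>F\<close>, found
    from an arbitrary end; both ends give the same one.\<close>
  define K where "K e = (adj F)\<^sup>* `` {SOME v. v \<in> e}" for e
  define c where "c e = (if e \<in> edges F then ff (K e) e else 2)" for e
  have K: "K e = (adj F)\<^sup>* `` {v}" if "e \<in> edges F" "v \<in> e" for v e
  proof -
    define w where "w = (SOME v. v \<in> e)"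
    have w: "w \<in> e" using that(2) unfolding w_def by (rule someI)
    have "card e = 2" using F'(4) that(1) by (auto simp: simple_graph_def)
    then have "w = v \<or> e = {w, v}" using w that(2) by (auto simp: card_2_iff)
    then have "(w, v) \<in> (adj F)\<^sup>*"
    proof
      assume "e = {w, v}"
      then have "(w, v) \<in> adj F" using that(1) by (simp add: adj_def)
      then show ?thesis by (rule r_into_rtrancl)
    qed simp
    from reachable_eq[OF this] show ?thesis unfolding K_def w_def[symmetric] .
  qed
  have comp: "(adj F)\<^sup>* `` {v} \<in> components F" if "v \<in> verts G" for v
    using that F'(1) by (auto simp: components_def)
  have two: "c e < 2" if "e \<in> edges F" for e
  proof -
    have "card e = 2" using F'(4) that by (auto simp: simple_graph_def)
    then obtain v where "v \<in> e" by (auto simp: card_2_iff)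
    moreover from this have "v \<in> verts G" using F'(1,4) that by (auto simp: simple_graph_def)
    ultimately have "P (K e) (ff (K e))" using ff comp K that by simp
    then show ?thesis using that by (simp add: c_def P_def)
  qed
  have "c e \<noteq> c e'"
    if v: "v \<in> W" and e: "e \<in> edges G" "e' \<in> edges G" "v \<in> e" "v \<in> e'" "e \<noteq> e'" for v e e'
  proof -
    have vG: "v \<in> verts G" using v W(1) by blast
    consider "e \<in> edges F" "e' \<in> edges F" | "e \<in> edges F \<longleftrightarrow> e' \<notin> edges F" | "e \<notin> edges F" "e' \<notin> edges F"
      by blast
    then show ?thesis
    proof cases
      case 1
      have "P (K e) (ff (K e))" using ff comp[OF vG] K 1 e by simp
      moreover have "v \<in> K e" "K e' = K e" using K 1 e by auto
      ultimately show ?thesis using 1 e v unfolding c_def P_def by simp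
    next
      case 2
      then show ?thesis using two[of e] two[of e'] by (auto simp: c_def split: if_splits)
    next
      case 3
      have c3: "card {e \<in> edges G. v \<in> e} = 3" using G(2) vG by (auto simp: regular_def degree_def)
      then have fin: "finite {e \<in> edges G. v \<in> e}" by (intro card_ge_0_finite) simp
      have c2: "card {e \<in> edges F. v \<in> e} = 2" using F'(1,3) vG by (auto simp: regular_def degree_def)
      have "card ({e \<in> edges F. v \<in> e} \<union> {e, e'}) \<le> 3"
        unfolding c3[symmetric] using e F'(2) by (intro card_mono fin) auto
      moreover have "card ({e \<in> edges F. v \<in> e} \<union> {e, e'}) = 2 + 2"
        using 3 e(5) c2 by (subst card_Un_disjoint) (auto intro: card_ge_0_finite)
      ultimately show ?thesis by simp
    qed
  qed
  moreover have "c e < 3" for e using two[of e] by (cases "e \<in> edges F") (auto simp: c_def)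
  ultimately show ?thesis by (intro exI[of _ c]) blast
qed

section \<open>Criteria for cyclic connectivity and oddness\<close>

text \<open>Every edge leaving the component \<open>C\<close> must have been deleted, so
  \<open>X = C\<close> gives a cut inside \<open>S\<close>, and the two cycles provide enough
  vertices on both sides. For cubic graphs and \<open>m = 4\<close> counting vertices loses nothing:
  a forest on \<open>n >= 2\<close> vertices is left by at least \<open>n + 2\<close> edges.\<close>

lemma cyclically_edge_connectedI:
  assumes G: "simple_graph G" and fin: "finite (edges G)"
    and cut: "\<And>X. X \<subseteq> verts G \<Longrightarrow> 2 \<le> card X \<Longrightarrow> 2 \<le> card (verts G - X) \<Longrightarrow>
      m \<le> card {e \<in> edges G. e \<inter> X \<noteq> {} \<and> \<not> e \<subseteq> X}"
  shows "cyclically_edge_connected m G"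
  unfolding cyclically_edge_connected_def
proof (rule notI, elim exE bexE conjE)
  fix S C D p q
  let ?H = "delete_edges G S"
  assume S: "S \<subseteq> edges G" "card S < m" and C: "C \<in> components ?H" and D: "D \<in> components ?H"
    and "C \<noteq> D" and p: "is_cycle ?H p" "set p \<subseteq> C" and q: "is_cycle ?H q" "set q \<subseteq> D"
  have H: "simple_graph ?H" "verts ?H = verts G" "edges ?H = edges G - S"
    using G by (auto simp: delete_edges_def simple_graph_def)
  have finV: "finite (verts G)" using G by (simp add: simple_graph_def)
  have sub: "C \<subseteq> verts G" "D \<subseteq> verts G"
    using component_subset[OF H(1) C] component_subset[OF H(1) D] H(2) by simp_all
  have disj: "C \<inter> D = {}"
    using component_eq[OF C] component_eq[OF D] \<open>C \<noteq> D\<close> by blast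
  have cyc: "2 \<le> card Y" if "is_cycle ?H r" "set r \<subseteq> Y" "finite Y" for r Y
  proof -
    have "card (set r) \<ge> 3" using that(1) by (simp add: is_cycle_def distinct_card)
    with card_mono[OF that(3,2)] show ?thesis by linarith
  qed
  have "2 \<le> card C" using cyc[OF p] sub(1) finV finite_subset by blast
  moreover have "2 \<le> card (verts G - C)" using q(2) sub(2) disj finV by (intro cyc[OF q(1)]) auto
  ultimately have m: "m \<le> card {e \<in> edges G. e \<inter> C \<noteq> {} \<and> \<not> e \<subseteq> C}"
    using cut sub(1) by blast
  have "{e \<in> edges G. e \<inter> C \<noteq> {} \<and> \<not> e \<subseteq> C} \<subseteq> S"
  proof (rule subsetI, rule ccontr)
    fix e assume e: "e \<in> {e \<in> edges G. e \<inter> C \<noteq> {} \<and> \<not> e \<subseteq> C}" "e \<notin> S"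
    then obtain u w where uw: "u \<in> e" "u \<in> C" "w \<in> e" "w \<notin> C" by blast
    have "card e = 2" using e G by (auto simp: simple_graph_def)
    then have "e = {u, w}" using uw by (auto simp: card_2_iff)
    then have "(u, w) \<in> adj ?H" using e H(3) by (simp add: adj_def)
    then have "w \<in> C" using component_eq[OF C uw(2)] by auto
    with uw(4) show False by simp
  qed
  then have "card {e \<in> edges G. e \<inter> C \<noteq> {} \<and> \<not> e \<subseteq> C} \<le> card S"
    using S(1) fin finite_subset by (intro card_mono) blast+
  with m S(2) show False by linarith
qed

text \<open>The 2-factor \<open>F0\<close> rules out the default value
  \<open>Inf {} = 0\<close>.\<close>

lemma oddnessI:
  assumes "two_factor G F0" "\<And>F. two_factor G F \<Longrightarrow> m \<le> card (odd_components F)"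
  shows "m \<le> oddness G"
  unfolding oddness_def using assms by (intro cInf_greatest) auto

section \<open>The Petersen fragment\<close>

text \<open>
  The vertex \<open>(j, i, t)\<close> lies in ring \<open>j < 2k\<close> and position \<open>i < 5\<close>. For \<open>t < 8\<close> it belongs to the
  fragment, whose pairs of dangling edges are at \<open>t = 0, 1\<close> (towards position \<open>i - 1\<close>) and at
  \<open>t = 2, 3\<close> (towards position \<open>i + 1\<close>); \<open>t = 8\<close> is the subdivision vertex towards position \<open>i + 1\<close>.
  The edge named \<open>(j, i, r)\<close> is inside the fragment for \<open>r < 10\<close>, goes from position \<open>i\<close> to
  \<open>i + 1\<close> for \<open>r = 10, 11, 12\<close>, and joins ring \<open>j\<close> to ring \<open>j + 1\<close> for \<open>r = 13\<close>. The lists give \<open>t\<close> for the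
  two ends of an edge as a function of \<open>r\<close>.
\<close>

definition tails :: "nat list" where "tails = [0, 0, 1, 1, 2, 2, 3, 3, 4, 5, 0, 3, 1, 8]"
definition heads :: "nat list" where "heads = [4, 5, 6, 7, 4, 6, 5, 7, 7, 6, 2, 8, 8, 8]"
text \<open>A finite check. Edge 8 joins vertices 4 and 7, so the pairs \<open>g 0, g 4\<close> and
  \<open>g 3, g 7\<close> are completed by the same third color; edge 9 does this for
  \<open>g 1, g 6\<close> and \<open>g 2, g 5\<close>. This leaves the 12 quadruples in
  \<open>Q\<close> for each, and the triples at vertices 0 to 3 decide the rest.\<close>

lemma fragment_coloring:
  fixes g :: "nat \<Rightarrow> nat"
  assumes lt: "\<And>r. r < 10 \<Longrightarrow> g r < 3" "a0 < 3" "a1 < 3" "b0 < 3" "b1 < 3"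
    and a: "distinct [g 0, g 1, a0]" "distinct [g 2, g 3, a1]"
    and b: "distinct [g 4, g 5, b0]" "distinct [g 6, g 7, b1]"
    and c: "distinct [g 0, g 4, g 8]" "distinct [g 1, g 6, g 9]"
      "distinct [g 2, g 5, g 9]" "distinct [g 3, g 7, g 8]"
  shows "a0 = a1 \<and> b0 = b1"
proof -
  define T :: "(nat \<times> nat \<times> nat) set"
    where "T = {(0, 1, 2), (0, 2, 1), (1, 0, 2), (1, 2, 0), (2, 0, 1), (2, 1, 0)}"
  have T: "(x, y, z) \<in> T" if "distinct [x, y, z]" "x < 3" "y < 3" "z < 3" for x y z
  proof -
    have "x = 0 \<or> x = 1 \<or> x = 2" "y = 0 \<or> y = 1 \<or> y = 2" "z = 0 \<or> z = 1 \<or> z = 2"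
      using that(2-4) by linarith+
    then show ?thesis using that(1) by (elim disjE) (simp_all add: T_def)
  qed
  define Q :: "(nat \<times> nat \<times> nat \<times> nat) set"
    where "Q = {(0, 1, 0, 1), (0, 1, 1, 0), (1, 0, 0, 1), (1, 0, 1, 0),
      (0, 2, 0, 2), (0, 2, 2, 0), (2, 0, 0, 2), (2, 0, 2, 0),
      (1, 2, 1, 2), (1, 2, 2, 1), (2, 1, 1, 2), (2, 1, 2, 1)}"
  have Q: "(u, v, x, y) \<in> Q" if "(u, v, w) \<in> T" "(x, y, w) \<in> T" for u v w x y
    using that unfolding T_def by (elim insertE emptyE) (simp_all add: Q_def)
  have "(g 0, g 4, g 3, g 7) \<in> Q" "(g 1, g 6, g 2, g 5) \<in> Q"
    using Q[OF T[OF c(1)] T[OF c(4)]] Q[OF T[OF c(2)] T[OF c(3)]] lt(1) by simp_all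
  moreover have "(g 0, g 1, a0) \<in> T" "(g 2, g 3, a1) \<in> T" "(g 4, g 5, b0) \<in> T" "(g 6, g 7, b1) \<in> T"
    using lt by (intro T a b; simp)+
  ultimately show ?thesis
    unfolding Q_def by (elim insertE emptyE) (simp_all add: T_def)
qed

lemma card_filter_less: "card {r. r < n \<and> P r} = (\<Sum>r<n. of_bool (P r))" for n :: nat
proof -
  have "{r. r < n \<and> P r} = {..<n} \<inter> {r. P r}" by auto
  then show ?thesis by simp
qed

text \<open>Used for a fragment that is split by a cut: being connected and bridgeless, it loses two
  edges. All choices of the sides \<open>x\<close> are tried, starting with the vertices 4 to
  7.\<close>

lemma fragment_cut:
  fixes x :: "nat \<Rightarrow> bool"
  assumes "s < 8" "t < 8" "x s \<noteq> x t"
  shows "2 \<le> card {r. r < 10 \<and> x (tails ! r) \<noteq> x (heads ! r)}"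
proof -
  have "\<not> (\<forall>t<8. x t = x 0)" using assms by metis
  then have "\<not> (x 1 = x 0 \<and> x 2 = x 0 \<and> x 3 = x 0 \<and> x 4 = x 0 \<and> x 5 = x 0 \<and> x 6 = x 0 \<and> x 7 = x 0)"
    by (auto simp: eval_nat_numeral less_Suc_eq)
  moreover have "card {r. r < 10 \<and> x (tails ! r) \<noteq> x (heads ! r)} =
    of_bool (x 0 \<noteq> x 4) + of_bool (x 0 \<noteq> x 5) + of_bool (x 1 \<noteq> x 6) + of_bool (x 1 \<noteq> x 7) +
    of_bool (x 2 \<noteq> x 4) + of_bool (x 2 \<noteq> x 6) + of_bool (x 3 \<noteq> x 5) + of_bool (x 3 \<noteq> x 7) +
    of_bool (x 4 \<noteq> x 7) + of_bool (x 5 \<noteq> x 6)"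
    unfolding card_filter_less by (simp add: eval_nat_numeral tails_def heads_def)
  ultimately show ?thesis
    by (cases "x 4"; cases "x 5"; cases "x 6"; cases "x 7"; simp; cases "x 0"; cases "x 1"; simp; cases "x 2"; cases "x 3"; simp)
qed

text \<open>The sum counts the edges leaving the side \<open>x\<close> in the Petersen graph, with
  both deleted vertices on the other side; the second summand counts the dangling edges. In the
  Petersen graph, a cut with at least two vertices on each side has at least four edges.\<close>

lemma fragment_cut_ports:
  fixes x :: "nat \<Rightarrow> bool"
  assumes "s < 8" "t < 8" "s \<noteq> t" "x s" "x t"
  shows "4 \<le> card {r. r < 10 \<and> x (tails ! r) \<noteq> x (heads ! r)} + card {t. t < 4 \<and> x t}"
proof -
  have "2 \<le> card {t. t < 8 \<and> x t}"
    using card_mono[of "{t. t < 8 \<and> x t}" "{s, t}"] assms by auto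
  then have "2 \<le> (of_bool (x 0) + of_bool (x 1) + of_bool (x 2) + of_bool (x 3) +
      of_bool (x 4) + of_bool (x 5) + of_bool (x 6) + of_bool (x 7) :: nat)"
    unfolding card_filter_less by (simp add: eval_nat_numeral)
  moreover have "card {r. r < 10 \<and> x (tails ! r) \<noteq> x (heads ! r)} =
    of_bool (x 0 \<noteq> x 4) + of_bool (x 0 \<noteq> x 5) + of_bool (x 1 \<noteq> x 6) + of_bool (x 1 \<noteq> x 7) +
    of_bool (x 2 \<noteq> x 4) + of_bool (x 2 \<noteq> x 6) + of_bool (x 3 \<noteq> x 5) + of_bool (x 3 \<noteq> x 7) +
    of_bool (x 4 \<noteq> x 7) + of_bool (x 5 \<noteq> x 6)"
    unfolding card_filter_less by (simp add: eval_nat_numeral tails_def heads_def)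
  moreover have "card {t. t < 4 \<and> x t} = of_bool (x 0) + of_bool (x 1) + of_bool (x 2) + of_bool (x 3)"
    unfolding card_filter_less by (simp add: eval_nat_numeral)
  ultimately show ?thesis
    by (cases "x 4"; cases "x 5"; cases "x 6"; cases "x 7"; simp; cases "x 0"; cases "x 1"; simp; cases "x 2"; cases "x 3"; simp)
qed

section \<open>The graph\<close>

text \<open>Edges are counted by their names and only later turned into sets. The condition on
  \<open>r = 13\<close> lets even rings send links at positions 0, 1, 2 and odd rings at positions
  3, 4, so each subdivision vertex has exactly one link.\<close>

definition edge_names :: "nat \<Rightarrow> (nat \<times> nat \<times> nat) set" where
  "edge_names k = {(j, i, r). j < 2 * k \<and> i < 5 \<and> r < 14 \<and> (r = 13 \<longrightarrow> (i < 3 \<longleftrightarrow> even j))}"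

definition tail :: "nat \<times> nat \<times> nat \<Rightarrow> nat \<times> nat \<times> nat" where
  "tail = (\<lambda>(j, i, r). (j, if r = 10 \<or> r = 12 then Suc i mod 5 else i, tails ! r))"

definition head :: "nat \<Rightarrow> nat \<times> nat \<times> nat \<Rightarrow> nat \<times> nat \<times> nat" where
  "head k = (\<lambda>(j, i, r). (if r = 13 then Suc j mod (2 * k) else j, i, heads ! r))"

definition places :: "nat \<Rightarrow> (nat \<times> nat \<times> nat) set" where
  "places k = {(j, i, t). j < 2 * k \<and> i < 5 \<and> t < 9}"

definition enc :: "nat \<times> nat \<times> nat \<Rightarrow> nat" where
  "enc = (\<lambda>(j, i, t). 45 * j + 9 * i + t)"

definition edge :: "nat \<Rightarrow> nat \<times> nat \<times> nat \<Rightarrow> nat set" where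
  "edge k n = {enc (tail n), enc (head k n)}"

definition ring_graph :: "nat \<Rightarrow> nat ugraph" where
  "ring_graph k = \<lparr>verts = {..<90 * k}, edges = edge k ` edge_names k\<rparr>"

definition cyc_pred :: "nat \<Rightarrow> nat \<Rightarrow> nat" where
  "cyc_pred n i = (if i = 0 then n - 1 else i - 1)"

lemma cyc_pred:
  assumes "i < n"
  shows "cyc_pred n i < n" "Suc (cyc_pred n i) mod n = i" "cyc_pred n (Suc i mod n) = i"
  using assms by (auto simp: cyc_pred_def mod_Suc)

lemma even_cyc_pred: "j < 2 * k \<Longrightarrow> even (cyc_pred (2 * k) j) = odd j"
  by (auto simp: cyc_pred_def)

text \<open>Facts about a single vertex thus reduce to evaluating its list. For \<open>t < 8\<close>
  the entries are ordered as in \<open>fragment_coloring\<close>; for \<open>t = 8\<close> parity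
  decides whether the link is sent by the vertex's own ring or by the preceding one.\<close>

definition incident :: "nat \<Rightarrow> nat \<times> nat \<times> nat \<Rightarrow> (nat \<times> nat \<times> nat) list" where
  "incident k = (\<lambda>(j, i, t).
    [[(j, i, 0), (j, i, 1), (j, cyc_pred 5 i, 10)],
     [(j, i, 2), (j, i, 3), (j, cyc_pred 5 i, 12)],
     [(j, i, 4), (j, i, 5), (j, i, 10)],
     [(j, i, 6), (j, i, 7), (j, i, 11)],
     [(j, i, 0), (j, i, 4), (j, i, 8)],
     [(j, i, 1), (j, i, 6), (j, i, 9)],
     [(j, i, 2), (j, i, 5), (j, i, 9)],
     [(j, i, 3), (j, i, 7), (j, i, 8)],
     [(j, i, 11), (j, i, 12),
      (if (i < 3) = even j then j else cyc_pred (2 * k) j, i, 13)]] ! t)"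

lemma less_9_cases: "t < 9 \<Longrightarrow> t = 0 \<or> t = 1 \<or> t = 2 \<or> t = 3 \<or> t = 4 \<or> t = 5 \<or> t = 6 \<or> t = 7 \<or> t = (8::nat)"
  by linarith

lemma less_14_cases: "r < 14 \<Longrightarrow> r = 0 \<or> r = 1 \<or> r = 2 \<or> r = 3 \<or> r = 4 \<or> r = 5 \<or> r = 6 \<or> r = 7 \<or>
    r = 8 \<or> r = 9 \<or> r = 10 \<or> r = 11 \<or> r = 12 \<or> r = (13::nat)"
  by (auto simp: numeral_eq_Suc less_Suc_eq)

section \<open>Encoding of the vertices and edges\<close>

lemma enc_eq_iff:
  assumes "i < 5" "t < 9" "i' < 5" "t' < 9"
  shows "enc (j, i, t) = enc (j', i', t') \<longleftrightarrow> j = j' \<and> i = i' \<and> t = t'"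
proof
  assume eq: "enc (j, i, t) = enc (j', i', t')"
  have "enc (a, b, c) div 45 = a" "enc (a, b, c) mod 45 div 9 = b" "enc (a, b, c) mod 9 = c"
    if "b < 5" "c < 9" for a b c
  proof -
    have *: "enc (a, b, c) = 45 * a + (9 * b + c)" "9 * b + c < 45" using that by (simp_all add: enc_def)
    show "enc (a, b, c) div 45 = a" using * by simp
    show "enc (a, b, c) mod 45 div 9 = b" using * that by simp
    have "enc (a, b, c) = 9 * (5 * a + b) + c" by (simp add: enc_def)
    then show "enc (a, b, c) mod 9 = c" by (simp only: mod_mult_self4 mod_less that)
  qed
  from this[of i t j] this[of i' t' j'] show "j = j' \<and> i = i' \<and> t = t'" using assms eq by simp
qed simp

lemma inj_on_enc: "inj_on enc (places k)"
  by (auto simp: inj_on_def places_def enc_eq_iff)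

lemma enc_image: "enc ` places k = {..<90 * k}"
proof (intro equalityI subsetI)
  fix n assume "n \<in> enc ` places k"
  then show "n \<in> {..<90 * k}" by (auto simp: places_def enc_def)
next
  fix n assume "n \<in> {..<90 * k}"
  then have "n div 45 < 2 * k" by (simp add: less_mult_imp_div_less)
  moreover have "n mod 45 div 9 < 5" by (simp add: less_mult_imp_div_less)
  moreover have "n = enc (n div 45, n mod 45 div 9, n mod 45 mod 9)"
    by (simp add: enc_def)
  ultimately show "n \<in> enc ` places k" by (force simp: places_def)
qed

text \<open>As the number of rings is even, parity alternates also where their cyclic order closes
  up.\<close>

lemma even_mod_double: "even (n mod (2 * k)) = even n" for n k :: nat
  by (metis dvd_mod_iff dvd_triv_left)

lemma tail_head_places:
  assumes "n \<in> edge_names k"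
  shows "tail n \<in> places k" "head k n \<in> places k"
proof -
  obtain j i r where n: "n = (j, i, r)" "j < 2 * k" "i < 5" "r < 14"
    using assms by (auto simp: edge_names_def)
  from less_14_cases[OF n(4)] n(1-3) show "tail n \<in> places k" "head k n \<in> places k"
    by (auto simp: places_def tail_def head_def tails_def heads_def)
qed

lemma name_incident:
  assumes "n \<in> edge_names k"
  shows "n \<in> set (incident k (tail n))" "n \<in> set (incident k (head k n))"
proof -
  obtain j i r where n: "n = (j, i, r)" "j < 2 * k" "i < 5" "r < 14" "r = 13 \<longrightarrow> (i < 3 \<longleftrightarrow> even j)"
    using assms by (auto simp: edge_names_def)
  from less_14_cases[OF n(4)] show "n \<in> set (incident k (tail n))" "n \<in> set (incident k (head k n))"
    using n(1,2,3,5) cyc_pred(3)[OF n(2)] cyc_pred(3)[OF n(3)]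
    by (elim disjE; simp add: tail_def head_def incident_def tails_def heads_def even_mod_double)+
qed

lemma incident_name:
  assumes v: "v \<in> places k" and n: "n \<in> set (incident k v)"
  shows "n \<in> edge_names k" "v \<in> {tail n, head k n}"
proof -
  obtain j i t where v': "v = (j, i, t)" "j < 2 * k" "i < 5" "t < 9"
    using v by (auto simp: places_def)
  note p = cyc_pred[OF v'(2)] cyc_pred[OF v'(3)] even_cyc_pred[OF v'(2)]
  have "\<forall>n \<in> set (incident k (j, i, t)). n \<in> edge_names k \<and> (j, i, t) \<in> {tail n, head k n}"
    using less_9_cases[OF v'(4)]
    by (elim disjE; simp add: edge_names_def tail_def head_def incident_def tails_def heads_def p v')
  with n v'(1) show "n \<in> edge_names k" "v \<in> {tail n, head k n}" by blast+
qed

lemma distinct_incident: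
  assumes "v \<in> places k"
  shows "distinct (incident k v)" "length (incident k v) = 3"
proof -
  obtain j i t where v': "v = (j, i, t)" "t < 9"
    using assms by (auto simp: places_def)
  from less_9_cases[OF v'(2)] show "distinct (incident k v)" "length (incident k v) = 3"
    by (elim disjE; simp add: v'(1) incident_def)+
qed

lemma incident_names:
  assumes "v \<in> places k"
  shows "{n \<in> edge_names k. v \<in> {tail n, head k n}} = set (incident k v)"
proof (intro equalityI subsetI)
  fix n assume "n \<in> {n \<in> edge_names k. v \<in> {tail n, head k n}}"
  then show "n \<in> set (incident k v)" using name_incident[of n k] by blast
next
  fix n assume "n \<in> set (incident k v)"
  with incident_name[OF assms this] show "n \<in> {n \<in> edge_names k. v \<in> {tail n, head k n}}" by blast
qed

text \<open>The unordered pair of the last coordinates of the ends of an edge determines \<open>r\<close>.\<close>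

lemma inj_on_ends: "inj_on (\<lambda>n. {tail n, head k n}) (edge_names k)"
proof (rule inj_onI)
  fix n n' assume n: "n \<in> edge_names k" "n' \<in> edge_names k"
    and eq: "{tail n, head k n} = {tail n', head k n'}"
  obtain j i r where n1: "n = (j, i, r)" "j < 2 * k" "i < 5" "r < 14" "r = 13 \<longrightarrow> (i < 3 \<longleftrightarrow> even j)"
    using n(1) by (auto simp: edge_names_def)
  obtain j' i' r' where n2: "n' = (j', i', r')" "j' < 2 * k" "i' < 5" "r' < 14" "r' = 13 \<longrightarrow> (i' < 3 \<longleftrightarrow> even j')"
    using n(2) by (auto simp: edge_names_def)
  have "(\<lambda>v. snd (snd v)) ` {tail n, head k n} = (\<lambda>v. snd (snd v)) ` {tail n', head k n'}"
    using eq by simp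
  then have *: "tails ! r = tails ! r' \<and> heads ! r = heads ! r' \<or>
      tails ! r = heads ! r' \<and> heads ! r = tails ! r'"
    by (auto simp: n1 n2 tail_def head_def doubleton_eq_iff)
  have "r = r'"
    using less_14_cases[OF n1(4)] less_14_cases[OF n2(4)] *
    by (elim disjE) (simp_all add: tails_def heads_def)
  show "n = n'"
  proof (cases "r = 13")
    case False
    then have "tails ! r \<noteq> heads ! r"
      using less_14_cases[OF n1(4)] by (elim disjE) (simp_all add: tails_def heads_def)
    with eq \<open>r = r'\<close> False show ?thesis
      by (auto simp: n1 n2 tail_def head_def doubleton_eq_iff)
  next
    \<comment> \<open>Both ends have last coordinate 8, so the pairs might match crosswise. Then
      \<open>j\<close> would be the ring after \<open>j'\<close>, but rings of different parity
      never send links at the same position.\<close>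
    case True
    then have "j = j' \<and> i = i' \<or> j = Suc j' mod (2 * k) \<and> i = i'"
      using eq \<open>r = r'\<close> by (auto simp: n1 n2 tail_def head_def doubleton_eq_iff tails_def heads_def)
    moreover have "\<not> (j = Suc j' mod (2 * k) \<and> i = i')"
      using n1(5) n2(5) True \<open>r = r'\<close> even_mod_double[of "Suc j'" k] by auto
    ultimately show ?thesis using n1(1) n2(1) \<open>r = r'\<close> by simp
  qed
qed

lemma inj_on_edge: "inj_on (edge k) (edge_names k)"
proof (rule inj_onI)
  fix n n' assume n: "n \<in> edge_names k" "n' \<in> edge_names k" and eq: "edge k n = edge k n'"
  have "enc ` {tail n, head k n} = enc ` {tail n', head k n'}"
    using eq by (simp add: edge_def)
  moreover have "{tail n, head k n} \<subseteq> places k" "{tail n', head k n'} \<subseteq> places k"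
    using tail_head_places n by simp_all
  ultimately have "{tail n, head k n} = {tail n', head k n'}"
    using inj_on_image_eq_iff[OF inj_on_enc[of k]] by blast
  then show "n = n'" using inj_onD[OF inj_on_ends _ n] by blast
qed

lemma tail_neq_head:
  assumes "n \<in> edge_names k"
  shows "tail n \<noteq> head k n"
proof
  assume eq: "tail n = head k n"
  obtain j i r where n: "n = (j, i, r)" "j < 2 * k" "i < 5" "r < 14"
    using assms by (auto simp: edge_names_def)
  have "even (Suc j mod (2 * k)) = odd j" by (simp add: even_mod_double)
  then have "j \<noteq> Suc j mod (2 * k)" by auto
  with eq less_14_cases[OF n(4)] show False
    by (elim disjE) (simp_all add: n(1) tail_def head_def tails_def heads_def)
qed

lemma enc_in_edge:
  assumes "v \<in> places k" "n \<in> edge_names k"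
  shows "enc v \<in> edge k n \<longleftrightarrow> v \<in> {tail n, head k n}"
  using inj_on_eq_iff[OF inj_on_enc assms(1)] tail_head_places[OF assms(2)] by (simp add: edge_def)

lemma incident_edges:
  assumes v: "v \<in> places k" and N: "N \<subseteq> edge_names k"
  shows "{e \<in> edge k ` N. enc v \<in> e} = edge k ` (set (incident k v) \<inter> N)"
  using enc_in_edge[OF v] incident_names[OF v] N by (fastforce simp: image_iff)

lemma degree_subgraph:
  assumes v: "v \<in> places k" and N: "N \<subseteq> edge_names k" and G: "edges G = edge k ` N"
  shows "degree G (enc v) = card (set (incident k v) \<inter> N)"
  unfolding degree_def G incident_edges[OF v N]
  using N by (intro card_image inj_on_subset[OF inj_on_edge]) auto

lemma finite_edge_names: "finite (edge_names k)"
  by (rule finite_subset[of _ "{..<2 * k} \<times> {..<5} \<times> {..<14}"]) (auto simp: edge_names_def)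

lemma simple_ring_graph: "simple_graph (ring_graph k)"
proof -
  have "edge k n \<subseteq> {..<90 * k} \<and> card (edge k n) = 2" if n: "n \<in> edge_names k" for n
  proof
    note p = tail_head_places[OF n]
    have "enc (tail n) \<in> enc ` places k" "enc (head k n) \<in> enc ` places k"
      using p by simp_all
    then show "edge k n \<subseteq> {..<90 * k}" unfolding enc_image by (simp add: edge_def)
    have "enc (tail n) \<noteq> enc (head k n)"
      using inj_on_eq_iff[OF inj_on_enc p] tail_neq_head[OF n] by simp
    then show "card (edge k n) = 2" by (simp add: edge_def)
  qed
  then show ?thesis by (auto simp: simple_graph_def ring_graph_def)
qed

lemma cubic_ring_graph: "cubic (ring_graph k)"
  unfolding regular_def
proof
  fix w assume "w \<in> verts (ring_graph k)"
  then have "w \<in> enc ` places k" by (simp add: ring_graph_def enc_image)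
  then obtain v where v: "v \<in> places k" "w = enc v" by blast
  have "set (incident k v) \<subseteq> edge_names k" using incident_names[OF v(1)] by blast
  then show "degree (ring_graph k) w = 3"
    using distinct_incident[OF v(1)] degree_subgraph[OF v(1) order_refl, of "ring_graph k"] v(2)
    by (simp add: ring_graph_def Int_absorb2 distinct_card)
qed

text \<open>Needed only to show that a 2-factor exists. The remaining edges, those with
  \<open>r\<close> in \<open>{1, 2, 4, 7, 13}\<close>, form a perfect matching.\<close>

lemma two_factor_ring_graph:
  "two_factor (ring_graph k) \<lparr>verts = {..<90 * k},
    edges = edge k ` {(j, i, r). (j, i, r) \<in> edge_names k \<and> r \<in> {0, 3, 5, 6, 8, 9, 10, 11, 12}}\<rparr>"
    (is "two_factor _ ?F")
proof -
  define N where "N = {(j, i, r). (j, i, r) \<in> edge_names k \<and> r \<in> {0, 3, 5, 6, 8, 9, 10, 11, 12}}"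
  have N: "N \<subseteq> edge_names k" by (auto simp: N_def)
  have "degree ?F w = 2" if "w \<in> verts ?F" for w
  proof -
    have "w \<in> enc ` places k" using that by (simp add: enc_image)
    then obtain v where v: "v \<in> places k" "w = enc v" by blast
    obtain j i t where v': "v = (j, i, t)" "t < 9"
      using v(1) by (auto simp: places_def)
    have sub: "set (incident k v) \<subseteq> edge_names k" using incident_names[OF v(1)] by blast
    define R where "R = filter (\<lambda>n. snd (snd n) \<in> {0, 3, 5, 6, 8, 9, 10, 11, 12}) (incident k v)"
    have "set (incident k v) \<inter> N = set R"
      using sub by (auto simp: N_def R_def)
    moreover have "distinct R" using distinct_incident(1)[OF v(1)] by (simp add: R_def)
    ultimately have "card (set (incident k v) \<inter> N) = length R" by (simp add: distinct_card)
    also have "length R = 2"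
      using less_9_cases[OF v'(2)] unfolding R_def v'(1)
      by (elim disjE) (simp_all add: incident_def)
    finally show ?thesis
      using degree_subgraph[OF v(1) N, of ?F] v(2) by (simp add: N_def)
  qed
  then show ?thesis using N by (auto simp: two_factor_def regular_def ring_graph_def N_def)
qed

section \<open>Blocks and oddness\<close>

definition block :: "nat \<Rightarrow> nat \<Rightarrow> (nat \<times> nat \<times> nat) set" where
  "block j i = {(j, i, t) | t. t < 9} \<union> {(j, Suc i mod 5, t) | t. t < 8}"

lemma block_places: "j < 2 * k \<Longrightarrow> i < 5 \<Longrightarrow> block j i \<subseteq> places k"
  by (auto simp: block_def places_def)

text \<open>The fragments at \<open>i\<close> and \<open>Suc i mod 5\<close> force the edges 10, 11
  and 12 at \<open>i\<close> to have the same color, but 11 and 12 meet at the subdivision vertex.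
  Properness is assumed at the vertices of the block only, because a coloring obtained from a
  2-factor offers no more.\<close>

lemma block_not_colorable:
  assumes j: "j < 2 * k" and i: "i < 5" and c: "\<And>e. e \<in> edges (ring_graph k) \<Longrightarrow> c e < (3::nat)"
    and proper: "\<And>v e e'. v \<in> enc ` block j i \<Longrightarrow> e \<in> edges (ring_graph k) \<Longrightarrow>
      e' \<in> edges (ring_graph k) \<Longrightarrow> v \<in> e \<Longrightarrow> v \<in> e' \<Longrightarrow> e \<noteq> e' \<Longrightarrow> c e \<noteq> c e'"
  shows False
proof -
  define g where "g n = c (edge k n)" for n
  have dist: "distinct (map g (incident k v))" if v: "v \<in> block j i" for v
  proof -
    have vp: "v \<in> places k" using v block_places[OF j i] by blast
    have "inj_on g (set (incident k v))"
    proof (rule inj_onI, rule ccontr)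
      fix n n' assume n: "n \<in> set (incident k v)" "n' \<in> set (incident k v)" "g n = g n'" "n \<noteq> n'"
      have n1: "n \<in> edge_names k" "enc v \<in> edge k n" "n' \<in> edge_names k" "enc v \<in> edge k n'"
        using incident_name[OF vp n(1)] incident_name[OF vp n(2)] enc_in_edge[OF vp] by auto
      then have "edge k n \<noteq> edge k n'" using inj_onD[OF inj_on_edge] n(4) by blast
      with proper[of "enc v" "edge k n" "edge k n'"] n1 v n(3) show False
        by (simp add: g_def ring_graph_def)
    qed
    then show ?thesis using distinct_incident(1)[OF vp] by (simp add: distinct_map)
  qed
  have g3: "g n < 3" if "n \<in> set (incident k v)" "v \<in> block j i" for n v
  proof -
    have "v \<in> places k" using that block_places[OF j i] by blast
    then show ?thesis using incident_name(1) that(1) c by (simp add: g_def ring_graph_def)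
  qed
  have element: "g (j, cyc_pred 5 l, 10) = g (j, cyc_pred 5 l, 12) \<and> g (j, l, 10) = g (j, l, 11)"
    if l: "\<And>t. t < 8 \<Longrightarrow> (j, l, t) \<in> block j i" for l
  proof (rule fragment_coloring[where g = "\<lambda>r. g (j, l, r)"])
    have d: "distinct (map g (incident k (j, l, t)))" if "t < 8" for t
      using dist l that by blast
    show "distinct [g (j, l, 0), g (j, l, 1), g (j, cyc_pred 5 l, 10)]"
      "distinct [g (j, l, 2), g (j, l, 3), g (j, cyc_pred 5 l, 12)]"
      "distinct [g (j, l, 4), g (j, l, 5), g (j, l, 10)]"
      "distinct [g (j, l, 6), g (j, l, 7), g (j, l, 11)]"
      "distinct [g (j, l, 0), g (j, l, 4), g (j, l, 8)]"
      "distinct [g (j, l, 1), g (j, l, 6), g (j, l, 9)]"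
      "distinct [g (j, l, 2), g (j, l, 5), g (j, l, 9)]"
      "distinct [g (j, l, 3), g (j, l, 7), g (j, l, 8)]"
      using d[of 0] d[of 1] d[of 2] d[of 3] d[of 4] d[of 5] d[of 6] d[of 7]
      by (simp_all add: incident_def)
    have b: "g n < 3" if "n \<in> set (incident k (j, l, t))" "t < 8" for n t
      using g3 l that by blast
    show "g (j, cyc_pred 5 l, 10) < 3" "g (j, cyc_pred 5 l, 12) < 3" "g (j, l, 10) < 3" "g (j, l, 11) < 3"
      by (rule b[of _ 0] b[of _ 1] b[of _ 2] b[of _ 3]; simp add: incident_def; fail)+
    fix r :: nat assume "r < 10"
    then have "(j, l, r) \<in> set (incident k (j, l, tails ! r))" "tails ! r < 8"
      using less_14_cases[of r] by (auto simp: tails_def incident_def)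
    then show "g (j, l, r) < 3" by (rule b)
  qed
  have "g (j, i, 10) = g (j, i, 11)"
    using element[of i] by (simp add: block_def)
  moreover have "g (j, i, 10) = g (j, i, 12)"
    using element[of "Suc i mod 5"] cyc_pred(3)[OF i] by (simp add: block_def)
  moreover have "g (j, i, 11) \<noteq> g (j, i, 12)"
    using dist[of "(j, i, 8)"] by (simp add: block_def incident_def)
  ultimately show False by simp
qed

lemma block_contains_odd_component:
  assumes "j < 2 * k" "i < 5" "two_factor (ring_graph k) F"
  shows "\<exists>C \<in> odd_components F. C \<subseteq> enc ` block j i"
proof (rule ccontr)
  assume "\<not> ?thesis"
  moreover have "enc ` block j i \<subseteq> verts (ring_graph k)"
    using image_mono[OF block_places[OF assms(1,2)], of enc] by (simp add: ring_graph_def enc_image)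
  ultimately obtain c :: "nat set \<Rightarrow> nat" where c: "\<forall>e. c e < 3"
    "\<forall>v \<in> enc ` block j i. \<forall>e \<in> edges (ring_graph k). \<forall>e' \<in> edges (ring_graph k).
      v \<in> e \<and> v \<in> e' \<and> e \<noteq> e' \<longrightarrow> c e \<noteq> c e'"
    using two_factor_coloring[OF simple_ring_graph cubic_ring_graph assms(3), of "enc ` block j i"] by metis
  show False
    by (rule block_not_colorable[OF assms(1,2), of c]) (use c in blast)+
qed

lemma not_edge_coloring_ring_graph:
  assumes "0 < k"
  shows "\<not> edge_coloring 3 (ring_graph k) c"
proof
  assume "edge_coloring 3 (ring_graph k) c"
  then show False
    using assms by (intro block_not_colorable[of 0 k 0 c]) (auto simp: edge_coloring_def)
qed

text \<open>The complement of a 5-cycle is a 5-cycle, which has chromatic number 3.\<close>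

lemma three_values_on_5_cycle:
  assumes "f 0 \<noteq> f 2" "f 2 \<noteq> f 4" "f 4 \<noteq> f 1" "f 1 \<noteq> f 3" "f 3 \<noteq> f (0::nat)"
  shows "3 \<le> card (f ` {..<5})"
proof -
  have sub: "3 \<le> card (f ` {..<5})" if "a < 5" "b < 5" "c < 5" "distinct [f a, f b, f c]" for a b c
    using card_mono[of "f ` {..<5}" "{f a, f b, f c}"] that by auto
  show ?thesis
  proof (cases "f 4 = f 0")
    case False
    then show ?thesis using assms by (intro sub[of 0 2 4]) auto
  next
    case True
    then show ?thesis using assms sub[of 0 2 1] sub[of 0 2 3] by (cases "f 1 = f 2") auto
  qed
qed

text \<open>A block occupies two consecutive positions, so it misses the block two positions
  further. The pairs run through the 5-cycle 0, 2, 4, 1, 3 as in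
  \<open>three_values_on_5_cycle\<close>.\<close>

lemma blocks_disjoint:
  assumes "j \<noteq> j' \<or> (i, i') \<in> {(0, 2), (2, 4), (4, 1), (1, 3), (3, 0)}"
    "i < 5" "i' < 5"
  shows "enc ` block j i \<inter> enc ` block j' i' = {}"
proof -
  have "block j i \<inter> block j' i' = {}" using assms by (auto simp: block_def)
  \<comment> \<open>\<open>Suc (j + j')\<close> is a value of \<open>k\<close> large enough for both
    rings; \<open>enc\<close> does not depend on \<open>k\<close>.\<close>
  moreover have "j < 2 * Suc (j + j')" "j' < 2 * Suc (j + j')" by simp_all
  ultimately show ?thesis
    using inj_on_image_Int[OF inj_on_enc block_places block_places, of j "Suc (j + j')" i j' i'] assms(2,3)
    by simp
qed

text \<open>Choose an odd component \<open>h j i\<close> in each block. Components are nonempty, so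
  disjoint blocks get different ones. Hence each ring contributes at least three, and different
  rings share none.\<close>

lemma oddness_ring_graph: "6 * k \<le> oddness (ring_graph k)"
proof (rule oddnessI[OF two_factor_ring_graph])
  fix F assume F: "two_factor (ring_graph k) F"
  have Fs: "simple_graph F"
    using F simple_ring_graph[of k] by (auto simp: two_factor_def simple_graph_def)
  have finV: "finite (verts F)" using Fs by (simp add: simple_graph_def)
  have fin: "finite (odd_components F)"
    using finV by (simp add: odd_components_def components_def)
  have ne: "C \<noteq> {}" if "C \<in> odd_components F" for C
    using that by (auto simp: odd_components_def)
  have "\<forall>j i. \<exists>C. j < 2 * k \<longrightarrow> i < 5 \<longrightarrow> C \<in> odd_components F \<and> C \<subseteq> enc ` block j i"
    using block_contains_odd_component[OF _ _ F] by blast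
  then obtain h where h: "\<And>j i. j < 2 * k \<Longrightarrow> i < 5 \<Longrightarrow> h j i \<in> odd_components F"
    "\<And>j i. j < 2 * k \<Longrightarrow> i < 5 \<Longrightarrow> h j i \<subseteq> enc ` block j i"
    by metis
  have neq: "h j i \<noteq> h j' i'"
    if "j < 2 * k" "j' < 2 * k" "i < 5" "i' < 5"
      "j \<noteq> j' \<or> (i, i') \<in> {(0, 2), (2, 4), (4, 1), (1, 3), (3, 0)}" for j j' i i'
  proof
    assume "h j i = h j' i'"
    then have "h j i \<subseteq> enc ` block j i \<inter> enc ` block j' i'"
      using h(2)[OF that(1,3)] h(2)[OF that(2,4)] by simp
    then show False using blocks_disjoint[OF that(5,3,4)] ne[OF h(1)[OF that(1,3)]] by simp
  qed
  have three: "3 \<le> card (h j ` {..<5})" if "j < 2 * k" for j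
    by (rule three_values_on_5_cycle; rule neq) (use that in simp_all)
  have "6 * k = (\<Sum>j<2 * k. 3)" by simp
  also have "\<dots> \<le> (\<Sum>j<2 * k. card (h j ` {..<5}))"
    using three by (intro sum_mono) simp
  also have "\<dots> = card (\<Union>j<2 * k. h j ` {..<5})"
  proof (intro card_UN_disjoint[symmetric] ballI impI)
    fix j j' assume "j \<in> {..<2 * k}" "j' \<in> {..<2 * k}" "j \<noteq> j'"
    then have "h j i \<noteq> h j' i'" if "i < 5" "i' < 5" for i i'
      using that by (intro neq) simp_all
    then show "h j ` {..<5} \<inter> h j' ` {..<5} = {}" by auto
  qed simp_all
  also have "\<dots> \<le> card (odd_components F)"
    using h(1) by (intro card_mono fin) auto
  finally show "6 * k \<le> card (odd_components F)" .
qed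

section \<open>Cyclic connectivity\<close>

lemma exists_step:
  fixes \<tau> :: "nat \<Rightarrow> 'b"
  assumes "p \<le> q" "\<tau> p \<noteq> \<tau> q"
  shows "\<exists>m. p \<le> m \<and> m < q \<and> \<tau> m \<noteq> \<tau> (Suc m)"
  using assms
proof (induction q rule: dec_induct)
  case (step q)
  then show ?case by (metis less_Suc_eq)
qed simp

text \<open>One change occurs on the way from 0 to \<open>j\<close>, another on the way from
  \<open>j\<close> back to 0, which is reached as \<open>n mod n\<close>.\<close>

lemma two_cyclic_steps:
  fixes \<sigma> :: "nat \<Rightarrow> 'b"
  assumes "j < n" "\<sigma> j \<noteq> \<sigma> 0"
  shows "\<exists>a b. a < n \<and> b < n \<and> a \<noteq> b \<and> \<sigma> a \<noteq> \<sigma> (Suc a mod n) \<and> \<sigma> b \<noteq> \<sigma> (Suc b mod n)"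
proof -
  obtain a where a: "a < j" "\<sigma> a \<noteq> \<sigma> (Suc a)"
    using exists_step[of 0 j \<sigma>] assms by auto
  obtain b where b: "j \<le> b" "b < n" "\<sigma> (b mod n) \<noteq> \<sigma> (Suc b mod n)"
    using exists_step[of j n "\<lambda>m. \<sigma> (m mod n)"] assms by auto
  have "Suc a mod n = Suc a" "b mod n = b" using a b assms(1) by simp_all
  then show ?thesis using a b assms(1) by (intro exI[of _ a] exI[of _ b]) simp
qed

section \<open>Cuts in terms of edge names\<close>

definition cut :: "nat \<Rightarrow> (nat \<times> nat \<times> nat \<Rightarrow> bool) \<Rightarrow> (nat \<times> nat \<times> nat) set" where
  "cut k x = {n \<in> edge_names k. x (tail n) \<noteq> x (head k n)}"

definition inner_cut :: "nat \<Rightarrow> (nat \<times> nat \<times> nat \<Rightarrow> bool) \<Rightarrow> nat \<Rightarrow> nat \<Rightarrow> (nat \<times> nat \<times> nat) set" where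
  "inner_cut k x j i = cut k x \<inter> {(j, i, r) | r. r < 10}"

text \<open>These sets are disjoint for different \<open>(j, i)\<close>, so in a cut of fewer than
  four edges at most one of them has two or more elements.\<close>

definition local_cut :: "nat \<Rightarrow> (nat \<times> nat \<times> nat \<Rightarrow> bool) \<Rightarrow> nat \<Rightarrow> nat \<Rightarrow> (nat \<times> nat \<times> nat) set" where
  "local_cut k x j i = cut k x \<inter> {(j, i, r) | r. r < 13}"

definition pure :: "(nat \<times> nat \<times> nat \<Rightarrow> bool) \<Rightarrow> nat \<Rightarrow> nat \<Rightarrow> bool" where
  "pure x j i \<longleftrightarrow> (\<forall>t<8. x (j, i, t) = x (j, i, 0))"

lemma pureD: "pure x j i \<Longrightarrow> t < 8 \<Longrightarrow> x (j, i, t) = x (j, i, 0)"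
  unfolding pure_def by blast

lemma finite_cut: "finite (cut k x)"
  using finite_edge_names by (simp add: cut_def)

lemma card_inner_cut:
  assumes "j < 2 * k" "i < 5"
  shows "card (inner_cut k x j i) = card {r. r < 10 \<and> x (j, i, tails ! r) \<noteq> x (j, i, heads ! r)}"
proof -
  have "inner_cut k x j i = (\<lambda>r. (j, i, r)) ` {r. r < 10 \<and> x (j, i, tails ! r) \<noteq> x (j, i, heads ! r)}"
    using assms by (auto simp: inner_cut_def cut_def edge_names_def tail_def head_def)
  then show ?thesis by (simp add: card_image inj_on_def)
qed

lemma inner_cut_impure:
  assumes "j < 2 * k" "i < 5" "\<not> pure x j i"
  shows "2 \<le> card (inner_cut k x j i)"
proof -
  obtain t where "t < 8" "x (j, i, t) \<noteq> x (j, i, 0)" using assms(3) by (auto simp: pure_def)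
  then show ?thesis
    using fragment_cut[of t 0 "\<lambda>t. x (j, i, t)"] card_inner_cut[OF assms(1,2)] by simp
qed

lemma local_cut_impure:
  assumes "j < 2 * k" "i < 5" "\<not> pure x j i"
  shows "2 \<le> card (local_cut k x j i)"
proof -
  have "card (inner_cut k x j i) \<le> card (local_cut k x j i)"
    using finite_cut by (intro card_mono) (auto simp: inner_cut_def local_cut_def)
  with inner_cut_impure[OF assms] show ?thesis by linarith
qed

lemma cut_links:
  assumes "j < 2 * k" "i < 5"
  shows "(j, i, 10) \<in> cut k x \<longleftrightarrow> x (j, Suc i mod 5, 0) \<noteq> x (j, i, 2)"
    "(j, i, 11) \<in> cut k x \<longleftrightarrow> x (j, i, 3) \<noteq> x (j, i, 8)"
    "(j, i, 12) \<in> cut k x \<longleftrightarrow> x (j, Suc i mod 5, 1) \<noteq> x (j, i, 8)"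
    "(i < 3) = even j \<Longrightarrow> (j, i, 13) \<in> cut k x \<longleftrightarrow> x (j, i, 8) \<noteq> x (Suc j mod (2 * k), i, 8)"
  using assms by (auto simp: cut_def edge_names_def tail_def head_def tails_def heads_def)

text \<open>With both fragments contracted, the edges 10, 11 and 12 form a triangle through the
  subdivision vertex. A cut meets a triangle in an even number of edges, hence here in none.\<close>

lemma local_cut_pure:
  assumes j: "j < 2 * k" "i < 5" and p: "pure x j i" "pure x j (Suc i mod 5)"
    and c: "card (local_cut k x j i) < 2"
  shows "x (j, Suc i mod 5, 0) = x (j, i, 0)" "x (j, i, 8) = x (j, i, 0)"
proof -
  have pe: "x (j, i, 2) = x (j, i, 0)" "x (j, i, 3) = x (j, i, 0)"
    "x (j, Suc i mod 5, 1) = x (j, Suc i mod 5, 0)"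
    by (rule pureD[OF p(1)] pureD[OF p(2)]; simp)+
  have two: "\<not> ((j, i, r) \<in> cut k x \<and> (j, i, r') \<in> cut k x)" if "r < 13" "r' < 13" "r \<noteq> r'" for r r'
  proof
    assume "(j, i, r) \<in> cut k x \<and> (j, i, r') \<in> cut k x"
    then have "{(j, i, r), (j, i, r')} \<subseteq> local_cut k x j i" using that by (auto simp: local_cut_def)
    then have "card {(j, i, r), (j, i, r')} \<le> card (local_cut k x j i)"
      using finite_cut by (intro card_mono) (auto simp: local_cut_def)
    with c that(3) show False by simp
  qed
  have "\<not> (x (j, Suc i mod 5, 0) \<noteq> x (j, i, 0) \<and> x (j, i, 0) \<noteq> x (j, i, 8))"
    "\<not> (x (j, Suc i mod 5, 0) \<noteq> x (j, i, 0) \<and> x (j, Suc i mod 5, 0) \<noteq> x (j, i, 8))"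
    "\<not> (x (j, i, 0) \<noteq> x (j, i, 8) \<and> x (j, Suc i mod 5, 0) \<noteq> x (j, i, 8))"
    using two[of 10 11] two[of 10 12] two[of 11 12] cut_links(1-3)[OF j] pe by simp_all
  then show "x (j, Suc i mod 5, 0) = x (j, i, 0)" "x (j, i, 8) = x (j, i, 0)" by blast+
qed

lemma ring_const:
  assumes "\<And>i. i < 5 \<Longrightarrow> f (Suc i mod 5) = f i" "i < (5::nat)"
  shows "f i = f 0"
  using assms(2)
proof (induction i)
  case (Suc i)
  then show ?case using assms(1)[of i] by simp
qed simp

text \<open>Without \<open>i0\<close> the five positions form a path of four vertices starting at
  \<open>Suc i0 mod 5\<close>.\<close>

lemma ring_const_except:
  assumes "\<And>i. i < 5 \<Longrightarrow> i \<noteq> i0 \<Longrightarrow> Suc i mod 5 \<noteq> i0 \<Longrightarrow> f (Suc i mod 5) = f i"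
    and "i0 < 5" "i < (5::nat)" "i \<noteq> i0"
  shows "f i = f (Suc i0 mod 5)"
proof -
  have g: "f ((Suc i0 + d) mod 5) = f (Suc i0 mod 5)" if "d \<le> 3" for d
    using that
  proof (induction d)
    case (Suc d)
    let ?i = "(Suc i0 + d) mod 5"
    have "?i \<noteq> i0" "Suc ?i mod 5 \<noteq> i0"
      using Suc.prems assms(2) by presburger+
    then have "f (Suc ?i mod 5) = f ?i" by (intro assms(1)) simp_all
    with Suc show ?case by (simp add: mod_Suc_eq)
  qed simp
  have "\<exists>d\<le>3. i = (Suc i0 + d) mod 5"
    using assms(2-4) by presburger
  then show ?thesis using g by blast
qed

text \<open>Each pair counted stands for a link \<open>(j, i, 13)\<close>. Going around the rings
  the side changes at least twice, and consecutive rings are joined by at least two links.\<close>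

lemma owners_card:
  assumes "j < n" "\<sigma> j \<noteq> \<sigma> (0::nat)"
  shows "4 \<le> card {(j, i :: nat). j < n \<and> i < 5 \<and> (i < 3) = even j \<and> \<sigma> j \<noteq> \<sigma> (Suc j mod n)}" (is "4 \<le> card ?O")
proof -
  obtain a b where ab: "a < n" "b < n" "a \<noteq> b" "\<sigma> a \<noteq> \<sigma> (Suc a mod n)" "\<sigma> b \<noteq> \<sigma> (Suc b mod n)"
    using two_cyclic_steps[of j n \<sigma>] assms by blast
  \<comment> \<open>Ring \<open>c\<close> sends links at the positions \<open>q c\<close> and
    \<open>Suc (q c)\<close>, whatever its parity.\<close>
  define q where "q c = (if even c then 0 else 3 :: nat)" for c :: nat
  have "finite ?O" by (rule finite_subset[of _ "{..<n} \<times> {..<5}"]) auto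
  moreover have "{(a, q a), (a, Suc (q a)), (b, q b), (b, Suc (q b))} \<subseteq> ?O"
    using ab by (auto simp: q_def)
  ultimately have "card {(a, q a), (a, Suc (q a)), (b, q b), (b, Suc (q b))} \<le> card ?O"
    by (rule card_mono)
  then show ?thesis using ab(3) by simp
qed

text \<open>If the rings \<open>j\<close> are not all on the same side, at least four edges joining different rings
  join sides \<open>\<sigma> j\<close> that differ; each vertex in \<open>E\<close> spoils at most one of them.\<close>

lemma sides_const:
  assumes cut: "card (cut k x) < 4" and B: "B \<subseteq> cut k x" "\<And>n. n \<in> B \<Longrightarrow> snd (snd n) < 13"
    and E: "finite E" "card E \<le> card B"
    and x: "\<And>j i. j < 2 * k \<Longrightarrow> i < 5 \<Longrightarrow> (j, i) \<notin> E \<Longrightarrow> x (j, i, 8) = \<sigma> j"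
    and j: "j < 2 * k"
  shows "\<sigma> j = \<sigma> 0"
proof (rule ccontr)
  assume "\<sigma> j \<noteq> \<sigma> 0"
  define Ow where "Ow = {(j, i :: nat). j < 2 * k \<and> i < 5 \<and> (i < 3) = even j \<and> \<sigma> j \<noteq> \<sigma> (Suc j mod (2 * k))}"
  \<comment> \<open>The ring and position that name the link at the subdivision vertex
    \<open>(j, i, 8)\<close>.\<close>
  define own where "own = (\<lambda>(j, i). (if (i < 3) = even j then j else cyc_pred (2 * k) j, i :: nat))"
  have O4: "4 \<le> card Ow" using owners_card[of j "2 * k" \<sigma>, OF j \<open>\<sigma> j \<noteq> \<sigma> 0\<close>] by (simp add: Ow_def)
  have "(j, i, 13) \<in> cut k x" if "(j, i) \<in> Ow - own ` E" for j i
  proof -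
    have ji: "j < 2 * k" "i < 5" "(i < 3) = even j" "\<sigma> j \<noteq> \<sigma> (Suc j mod (2 * k))" "(j, i) \<notin> own ` E"
      using that by (auto simp: Ow_def)
    have "own (j, i) = (j, i)" "own (Suc j mod (2 * k), i) = (j, i)"
      using ji(3) cyc_pred(3)[OF ji(1)] by (simp_all add: own_def even_mod_double)
    then have "(j, i) \<notin> E" "(Suc j mod (2 * k), i) \<notin> E" using ji(5) by force+
    then have "x (j, i, 8) = \<sigma> j" "x (Suc j mod (2 * k), i, 8) = \<sigma> (Suc j mod (2 * k))"
      using x ji(1,2) by simp_all
    then show ?thesis using cut_links(4)[OF ji(1-3)] ji(4) by simp
  qed
  then have "(\<lambda>(j, i). (j, i, 13)) ` (Ow - own ` E) \<subseteq> cut k x" by auto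
  moreover have "B \<inter> (\<lambda>(j, i). (j, i, 13)) ` (Ow - own ` E) = {}" using B(2) by force
  moreover have "finite B" using B(1) finite_cut finite_subset by blast
  moreover have "finite Ow" using O4 by (intro card_ge_0_finite) simp
  \<comment> \<open>The vertices in \<open>E\<close> spoil at most \<open>card E\<close> of at least
    four links, so with \<open>B\<close> the cut has at least
    \<open>card B + (4 - card E) >= 4\<close> edges.\<close>
  ultimately have "card B + card ((\<lambda>(j, i). (j, i, 13::nat)) ` (Ow - own ` E)) \<le> card (cut k x)"
    using B(1) finite_cut by (subst card_Un_disjoint[symmetric]) (auto intro!: card_mono)
  moreover have "card ((\<lambda>(j, i). (j, i, 13::nat)) ` (Ow - own ` E)) = card (Ow - own ` E)"
    by (intro card_image) (auto simp: inj_on_def)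
  moreover have "card Ow - card (own ` E) \<le> card (Ow - own ` E)"
    using E(1) by (intro diff_card_le_card_Diff) simp
  moreover have "card (own ` E) \<le> card E" using E(1) by (rule card_image_le)
  ultimately show False using O4 cut E(2) by linarith
qed

text \<open>At most one place \<open>(j0, i0)\<close> has a local cut of size two or more. Elsewhere
  \<open>local_cut_pure\<close> carries the side from one fragment to the next, and the other four
  fragments of ring \<open>j0\<close> still form a path. Only the fragment at \<open>i0\<close> and
  the subdivision vertices before and after it may deviate; if this fragment is pure, only the one
  after it.\<close>

lemma small_cut_structure:
  assumes k: "0 < k" and cut: "card (cut k x) < 4"
  obtains (uniform) \<sigma> where "\<And>j i t. (j, i, t) \<in> places k \<Longrightarrow> x (j, i, t) = \<sigma> j"
    | (exception) \<sigma> j0 i0 where "j0 < 2 * k" "i0 < 5" "2 \<le> card (local_cut k x j0 i0)"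
      "\<And>j i t. j < 2 * k \<Longrightarrow> i < 5 \<Longrightarrow> t < 8 \<Longrightarrow> (j, i) \<noteq> (j0, i0) \<Longrightarrow> x (j, i, t) = \<sigma> j"
      "\<And>j i. j < 2 * k \<Longrightarrow> i < 5 \<Longrightarrow> (j, i) \<notin> {(j0, i0), (j0, cyc_pred 5 i0)} \<Longrightarrow> x (j, i, 8) = \<sigma> j"
      "\<And>t. pure x j0 i0 \<Longrightarrow> t < 8 \<Longrightarrow> x (j0, i0, t) = \<sigma> j0"
      "pure x j0 i0 \<Longrightarrow> x (j0, cyc_pred 5 i0, 8) = \<sigma> j0"
proof (cases "\<exists>j i. j < 2 * k \<and> i < 5 \<and> 2 \<le> card (local_cut k x j i)")
  case False
  then have good: "card (local_cut k x j i) < 2" if "j < 2 * k" "i < 5" for j i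
    using that by (meson not_le)
  have pure: "pure x j i" if "j < 2 * k" "i < 5" for j i
    using local_cut_impure[of j k i x] good[OF that] that by linarith
  have step: "x (j, Suc i mod 5, 0) = x (j, i, 0)" "x (j, i, 8) = x (j, i, 0)"
    if "j < 2 * k" "i < 5" for j i
    using that by (intro local_cut_pure[OF that pure pure good]; simp)+
  have const: "x (j, i, 0) = x (j, 0, 0)" if "j < 2 * k" "i < 5" for j i
    using ring_const[of "\<lambda>i. x (j, i, 0)" i] step(1) that by blast
  have "x (j, i, t) = x (j, 0, 0)" if "(j, i, t) \<in> places k" for j i t
  proof -
    have jit: "j < 2 * k" "i < 5" "t < 8 \<or> t = 8" using that by (auto simp: places_def)
    then have "x (j, i, t) = x (j, i, 0)"
      using pureD[OF pure[OF jit(1,2)]] step(2) by blast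
    then show ?thesis using const[OF jit(1,2)] by simp
  qed
  then show ?thesis by (rule uniform)
next
  case True
  then obtain j0 i0 where bad: "j0 < 2 * k" "i0 < 5" "2 \<le> card (local_cut k x j0 i0)" by blast
  have good: "card (local_cut k x j i) < 2" if "(j, i) \<noteq> (j0, i0)" for j i
  proof -
    have "local_cut k x j0 i0 \<inter> local_cut k x j i = {}" using that by (auto simp: local_cut_def)
    moreover have fin: "finite (local_cut k x j i)" for j i
      using finite_cut by (simp add: local_cut_def)
    moreover have "card (local_cut k x j0 i0 \<union> local_cut k x j i) \<le> card (cut k x)"
      using finite_cut by (intro card_mono) (auto simp: local_cut_def)
    ultimately have "card (local_cut k x j0 i0) + card (local_cut k x j i) \<le> card (cut k x)"
      by (simp add: card_Un_disjoint)
    with bad(3) cut show ?thesis by linarith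
  qed
  have pure: "pure x j i" if "j < 2 * k" "i < 5" "(j, i) \<noteq> (j0, i0)" for j i
    using local_cut_impure[of j k i x] good[OF that(3)] that by linarith
  have step: "x (j, Suc i mod 5, 0) = x (j, i, 0)" "x (j, i, 8) = x (j, i, 0)"
    if "j < 2 * k" "i < 5" "(j, i) \<noteq> (j0, i0)" "pure x j (Suc i mod 5)" for j i
    by (rule local_cut_pure[OF that(1,2) pure[OF that(1-3)] that(4) good[OF that(3)]])+
  \<comment> \<open>In ring \<open>j0\<close> the reference fragment has to avoid the exceptional
    one; it is the start of the path in \<open>ring_const_except\<close>.\<close>
  define \<sigma> where "\<sigma> j = x (j, if j = j0 then Suc i0 mod 5 else 0, 0)" for j
  have const: "x (j, i, 0) = \<sigma> j" if ji: "j < 2 * k" "i < 5" "(j, i) \<noteq> (j0, i0)" for j i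
  proof (cases "j = j0")
    case True
    have "x (j0, i, 0) = x (j0, Suc i0 mod 5, 0)"
    proof (rule ring_const_except[of i0 "\<lambda>i. x (j0, i, 0)"])
      fix i assume i: "i < (5::nat)" "i \<noteq> i0" "Suc i mod 5 \<noteq> i0"
      show "x (j0, Suc i mod 5, 0) = x (j0, i, 0)"
        by (rule step(1)[OF bad(1) i(1) _ pure[OF bad(1)]]) (use i in simp_all)
    qed (use bad ji True in simp_all)
    then show ?thesis by (simp add: \<sigma>_def True)
  next
    case False
    have "x (j, i, 0) = x (j, 0, 0)"
    proof (rule ring_const[of "\<lambda>i. x (j, i, 0)"])
      fix i assume i: "i < (5::nat)"
      show "x (j, Suc i mod 5, 0) = x (j, i, 0)"
        by (rule step(1)[OF ji(1) i _ pure[OF ji(1)]]) (use False in simp_all)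
    qed (rule ji(2))
    then show ?thesis by (simp add: \<sigma>_def False)
  qed
  have pred: "cyc_pred 5 i0 < 5" "Suc (cyc_pred 5 i0) mod 5 = i0" "cyc_pred 5 i0 \<noteq> i0"
    using cyc_pred(1,2)[OF bad(2)] bad(2) by (auto simp: cyc_pred_def)
  show ?thesis
  proof (rule exception[OF bad])
    fix j i t assume ji: "j < 2 * k" "i < 5" "t < (8::nat)" "(j, i) \<noteq> (j0, i0)"
    show "x (j, i, t) = \<sigma> j"
      using pureD[OF pure[OF ji(1,2,4)] ji(3)] const[OF ji(1,2,4)] by simp
  next
    fix j i assume ji: "j < 2 * k" "i < 5" "(j, i) \<notin> {(j0, i0), (j0, cyc_pred 5 i0)}"
    then have "(j, Suc i mod 5) \<noteq> (j0, i0)" using cyc_pred(3)[OF ji(2)] by auto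
    then have "pure x j (Suc i mod 5)" using ji(1) by (intro pure) simp_all
    then have "x (j, i, 8) = x (j, i, 0)" using ji by (intro step) simp_all
    then show "x (j, i, 8) = \<sigma> j" using const[of j i] ji by simp
  next
    \<comment> \<open>The local cut at the preceding position is small, so it ties this fragment to
      its predecessor.\<close>
    assume p: "pure x j0 i0"
    have s: "x (j0, i0, 0) = x (j0, cyc_pred 5 i0, 0)" "x (j0, cyc_pred 5 i0, 8) = x (j0, cyc_pred 5 i0, 0)"
      using step[of j0 "cyc_pred 5 i0"] bad(1) p pred by simp_all
    show "x (j0, cyc_pred 5 i0, 8) = \<sigma> j0"
      using s const[of j0 "cyc_pred 5 i0"] bad(1) pred by simp
    fix t :: nat assume "t < 8"
    then show "x (j0, i0, t) = \<sigma> j0"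
      using pureD[OF p] s const[of j0 "cyc_pred 5 i0"] bad(1) pred by simp
  qed
qed

text \<open>In the exceptional case all rings agree on a side \<open>s\<close>, and two vertices
  \<open>v\<close>, \<open>v'\<close> deviate from it. A split fragment already gives two cut edges.
  A deviating subdivision vertex next to it would add two more; otherwise \<open>v\<close> and
  \<open>v'\<close> lie in the fragment and \<open>fragment_cut_ports\<close> applies.\<close>

lemma cut_ge_4:
  assumes k: "0 < k"
    and u: "u \<in> places k" "u' \<in> places k" "u \<noteq> u'" "x u" "x u'"
    and w: "w \<in> places k" "w' \<in> places k" "w \<noteq> w'" "\<not> x w" "\<not> x w'"
  shows "4 \<le> card (cut k x)"
proof (rule ccontr)
  assume "\<not> 4 \<le> card (cut k x)"
  then have cut: "card (cut k x) < 4" by simp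
  show False
  proof (cases rule: small_cut_structure[OF k cut])
    case (1 \<sigma>)
    have const: "\<sigma> j = \<sigma> 0" if "j < 2 * k" for j
      using that by (intro sides_const[OF cut, of "{}" "{}"]) (use 1 in \<open>auto simp: places_def\<close>)
    have "x v = \<sigma> 0" if "v \<in> places k" for v
    proof -
      obtain j i t where v: "v = (j, i, t)" by (cases v)
      with that have j: "j < 2 * k" by (simp add: places_def)
      show ?thesis using const[OF j] 1[of j i t] that v by simp
    qed
    from this[OF u(1)] this[OF w(1)] show False using u(4) w(4) by simp
  next
    case (2 \<sigma> j0 i0)
    define i1 where "i1 = cyc_pred 5 i0"
    define s where "s = \<sigma> 0"
    have i1: "i1 < 5" "Suc i1 mod 5 = i0" "i1 \<noteq> i0" "Suc i0 mod 5 \<noteq> i0"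
      using cyc_pred(1,2)[OF 2(2)] 2(2) by (auto simp: i1_def cyc_pred_def mod_Suc)
    have s: "\<sigma> j = s" if "j < 2 * k" for j
      unfolding s_def
    proof (rule sides_const[OF cut _ _ _ _ _ that])
      show "local_cut k x j0 i0 \<subseteq> cut k x" "\<And>n. n \<in> local_cut k x j0 i0 \<Longrightarrow> snd (snd n) < 13"
        by (auto simp: local_cut_def)
      \<comment> \<open>The two subdivision vertices that may deviate are paid for by two edges of
        the local cut.\<close>
      show "card {(j0, i0), (j0, i1)} \<le> card (local_cut k x j0 i0)"
        using 2(3) i1(3) by simp
    qed (use 2(5) in \<open>simp_all add: i1_def\<close>)
    have x: "\<And>j i t. j < 2 * k \<Longrightarrow> i < 5 \<Longrightarrow> t < 8 \<Longrightarrow> (j, i) \<noteq> (j0, i0) \<Longrightarrow> x (j, i, t) = s"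
      "\<And>j i. j < 2 * k \<Longrightarrow> i < 5 \<Longrightarrow> (j, i) \<notin> {(j0, i0), (j0, i1)} \<Longrightarrow> x (j, i, 8) = s"
      "\<And>t. pure x j0 i0 \<Longrightarrow> t < 8 \<Longrightarrow> x (j0, i0, t) = s"
      "pure x j0 i0 \<Longrightarrow> x (j0, i1, 8) = s"
      using 2(4-7) s[symmetric] s[OF 2(1), symmetric] by (simp_all add: i1_def)
    obtain v v' where v: "v \<in> places k" "v' \<in> places k" "v \<noteq> v'" "x v \<noteq> s" "x v' \<noteq> s"
    proof (cases s)
      case True
      then show ?thesis using w by (intro that[of w w']) simp_all
    next
      case False
      then show ?thesis using u by (intro that[of u u']) simp_all
    qed
    have exc: "(\<exists>t<8. v = (j0, i0, t)) \<or> v = (j0, i0, 8) \<or> v = (j0, i1, 8)"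
      if "v \<in> places k" "x v \<noteq> s" for v
    proof -
      obtain j i t where v: "v = (j, i, t)" by (cases v)
      with that(1) have jit: "j < 2 * k" "i < 5" "t < 8 \<or> t = 8"
        by (auto simp: places_def)
      then show ?thesis using x(1)[of j i t] x(2)[of j i] that(2) v by auto
    qed
    \<comment> \<open>For a pure fragment only \<open>(j0, i0, 8)\<close> could deviate, but there
      are two deviating vertices.\<close>
    have impure: "\<not> pure x j0 i0"
    proof
      assume "pure x j0 i0"
      then have "v = (j0, i0, 8)" if "v \<in> places k" "x v \<noteq> s" for v
        using exc[OF that] x(3,4) that(2) by blast
      then show False using v by blast
    qed
    have inner: "2 \<le> card (inner_cut k x j0 i0)" "inner_cut k x j0 i0 \<subseteq> cut k x"
      using inner_cut_impure[OF 2(1,2) impure] by (auto simp: inner_cut_def)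
    have extra: False if "a \<in> cut k x" "b \<in> cut k x" "a \<noteq> b" "10 \<le> snd (snd a)" "10 \<le> snd (snd b)" for a b
    proof -
      have "a \<notin> inner_cut k x j0 i0" "b \<notin> inner_cut k x j0 i0"
        using that(4,5) by (auto simp: inner_cut_def)
      moreover have "finite (inner_cut k x j0 i0)" using inner(2) finite_cut finite_subset by blast
      ultimately have "card (insert a (insert b (inner_cut k x j0 i0))) = Suc (Suc (card (inner_cut k x j0 i0)))"
        using that(3) by simp
      moreover have "card (insert a (insert b (inner_cut k x j0 i0))) \<le> card (cut k x)"
        using that(1,2) inner(2) finite_cut by (intro card_mono) auto
      ultimately show False using inner(1) cut by linarith
    qed
    \<comment> \<open>The link at a deviating subdivision vertex leads to a different ring, where
      everything is on side \<open>s\<close>.\<close>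
    have out: "\<exists>n \<in> cut k x. snd (snd n) = 13" if i: "i < 5" "x (j0, i, 8) \<noteq> s" for i
    proof (cases "(i < 3) = even j0")
      case True
      have "even (Suc j0 mod (2 * k)) = odd j0" by (simp add: even_mod_double)
      then have "Suc j0 mod (2 * k) \<noteq> j0" by auto
      then have "x (Suc j0 mod (2 * k), i, 8) = s" using k i by (intro x(2)) auto
      then have "(j0, i, 13) \<in> cut k x" using cut_links(4)[OF 2(1) i(1) True] i(2) by simp
      then show ?thesis by force
    next
      case False
      let ?j = "cyc_pred (2 * k) j0"
      have j: "?j < 2 * k" "Suc ?j mod (2 * k) = j0" using cyc_pred[OF 2(1)] by simp_all
      have par: "even ?j = odd j0" using even_cyc_pred 2(1) by blast
      then have "?j \<noteq> j0" by auto
      then have "x (?j, i, 8) = s" using j i by (intro x(2)) auto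
      moreover have "(i < 3) = even ?j" using par False by blast
      ultimately have "(?j, i, 13) \<in> cut k x" using cut_links(4)[OF j(1) i(1), of x] j(2) i(2) by simp
      then show ?thesis by force
    qed
    \<comment> \<open>Besides its link, a deviating vertex here would have edge 12 to the next
      fragment in the cut; in \<open>y1\<close> it is edge 11 from the preceding fragment.\<close>
    have y0: "x (j0, i0, 8) = s"
    proof (rule ccontr)
      assume y: "x (j0, i0, 8) \<noteq> s"
      have "x (j0, Suc i0 mod 5, 1) = s" using 2(1) i1(4) by (intro x(1)) simp_all
      then have "(j0, i0, 12) \<in> cut k x" using cut_links(3)[OF 2(1,2), of x] y by simp
      moreover obtain n where "n \<in> cut k x" "snd (snd n) = 13" using out[OF 2(2) y] by blast
      ultimately show False using extra[of "(j0, i0, 12)" n] by force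
    qed
    have y1: "x (j0, i1, 8) = s"
    proof (rule ccontr)
      assume y: "x (j0, i1, 8) \<noteq> s"
      have "x (j0, i1, 3) = s" using 2(1) i1 by (intro x(1)) simp_all
      then have "(j0, i1, 11) \<in> cut k x" using cut_links(2)[OF 2(1) i1(1), of x] y by simp
      moreover obtain n where "n \<in> cut k x" "snd (snd n) = 13" using out[OF i1(1) y] by blast
      ultimately show False using extra[of "(j0, i1, 11)" n] by force
    qed
    obtain t t' where t: "v = (j0, i0, t)" "v' = (j0, i0, t')" "t < 8" "t' < 8"
      using exc[OF v(1,4)] exc[OF v(2,5)] y0 y1 v(4,5) by auto
    \<comment> \<open>\<open>port t\<close> is the edge leaving the exceptional fragment at its
      vertex \<open>t < 4\<close>; by now its other end is known to be on side
      \<open>s\<close>.\<close>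
    define port where "port = (!) [(j0, i1, 10), (j0, i1, 12), (j0, i0, 10), (j0, i0, 11 :: nat)]"
    define T where "T = {t. t < 4 \<and> x (j0, i0, t) \<noteq> s}"
    have four: "t = 0 \<or> t = 1 \<or> t = 2 \<or> t = 3" if "t < 4" for t :: nat using that by linarith
    have port_cut: "port t \<in> cut k x" if "t \<in> T" for t
    proof -
      have xt: "x (j0, i0, t) \<noteq> s" "t < 4" using that by (simp_all add: T_def)
      have "x (j0, i1, 2) = s" "x (j0, Suc i0 mod 5, 0) = s"
        by (rule x(1); use 2(1) i1 in simp)+
      then show ?thesis
        using four[OF xt(2)] xt(1) cut_links[OF 2(1,2), of x] cut_links[OF 2(1) i1(1), of x] y0 y1 i1(2)
        by (elim disjE) (simp_all add: port_def)
    qed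
    have "inj_on port {..<4}"
    proof (rule inj_onI)
      fix a b assume ab: "a \<in> {..<4::nat}" "b \<in> {..<4::nat}" and eq: "port a = port b"
      from ab have "a < 4" "b < 4" by simp_all
      from four[OF this(1)] four[OF this(2)] eq i1(3) show "a = b"
        by (elim disjE) (simp_all add: port_def)
    qed
    then have "card (port ` T) = card T"
      by (intro card_image) (auto simp: T_def intro: inj_on_subset)
    moreover have "port ` T \<inter> inner_cut k x j0 i0 = {}"
    proof -
      have "10 \<le> snd (snd (port t))" if "t < 4" for t
        using four[OF that] by (elim disjE) (simp_all add: port_def)
      then show ?thesis by (fastforce simp: T_def inner_cut_def)
    qed
    moreover have "card (port ` T \<union> inner_cut k x j0 i0) \<le> card (cut k x)"
      using port_cut inner(2) finite_cut by (intro card_mono) auto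
    moreover have "finite (inner_cut k x j0 i0)" using inner(2) finite_cut finite_subset by blast
    moreover have "finite T" by (simp add: T_def)
    ultimately have "card T + card (inner_cut k x j0 i0) \<le> card (cut k x)"
      by (simp add: card_Un_disjoint)
    moreover have "4 \<le> card (inner_cut k x j0 i0) + card T"
      using fragment_cut_ports[of t t' "\<lambda>t. x (j0, i0, t) \<noteq> s"] t v card_inner_cut[OF 2(1,2), of x]
      by (cases s) (simp_all add: T_def)
    ultimately show False using cut by linarith
  qed
qed
lemma cyclically_4_edge_connected_ring_graph:
  assumes k: "0 < k"
  shows "cyclically_edge_connected 4 (ring_graph k)"
proof (rule cyclically_edge_connectedI[OF simple_ring_graph])
  show "finite (edges (ring_graph k))" by (simp add: ring_graph_def finite_edge_names)
  fix X assume X: "X \<subseteq> verts (ring_graph k)" "2 \<le> card X" "2 \<le> card (verts (ring_graph k) - X)"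
  have verts: "verts (ring_graph k) = enc ` places k" by (simp add: ring_graph_def enc_image)
  have two: "\<exists>u u'. u \<in> places k \<and> u' \<in> places k \<and> u \<noteq> u' \<and> enc u \<in> Y \<and> enc u' \<in> Y"
    if Y: "Y \<subseteq> enc ` places k" "2 \<le> card Y" for Y
  proof -
    obtain Z where "Z \<subseteq> Y" "card Z = 2" by (rule obtain_subset_with_card_n[OF Y(2)])
    then obtain a b where ab: "a \<in> Y" "b \<in> Y" "a \<noteq> b" by (auto simp: card_2_iff)
    then obtain u u' where "u \<in> places k" "u' \<in> places k" "a = enc u" "b = enc u'" using Y(1) by blast
    with ab show ?thesis by blast
  qed
  obtain u u' where u: "u \<in> places k" "u' \<in> places k" "u \<noteq> u'" "enc u \<in> X" "enc u' \<in> X"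
    using two[of X] X(1,2) verts by auto
  obtain w w' where w: "w \<in> places k" "w' \<in> places k" "w \<noteq> w'" "enc w \<notin> X" "enc w' \<notin> X"
    using two[of "enc ` places k - X"] X(3) verts by auto
  have "4 \<le> card (cut k (\<lambda>v. enc v \<in> X))"
    by (rule cut_ge_4[OF k u(1-3) _ _ w(1-3)]) (use u w in simp_all)
  also have "\<dots> = card (edge k ` cut k (\<lambda>v. enc v \<in> X))"
    by (intro card_image[symmetric] inj_on_subset[OF inj_on_edge]) (auto simp: cut_def)
  also have "\<dots> \<le> card {e \<in> edges (ring_graph k). e \<inter> X \<noteq> {} \<and> \<not> e \<subseteq> X}"
    by (rule card_mono) (auto simp: ring_graph_def cut_def edge_def finite_edge_names)
  finally show "4 \<le> card {e \<in> edges (ring_graph k). e \<inter> X \<noteq> {} \<and> \<not> e \<subseteq> X}" .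
qed

theorem corollary2p7:
  fixes k :: nat
  assumes "k \<ge> 1"
  shows "\<exists>G :: nat ugraph. snark G \<and> card (verts G) = 90 * k \<and> oddness G \<ge> 6 * k"
proof (intro exI conjI)
  have k: "0 < k" using assms by simp
  show "snark (ring_graph k)"
    unfolding snark_def
    using simple_ring_graph cubic_ring_graph cyclically_4_edge_connected_ring_graph[OF k]
      not_edge_coloring_ring_graph[OF k] by blast
  show "card (verts (ring_graph k)) = 90 * k" by (simp add: ring_graph_def)
  show "6 * k \<le> oddness (ring_graph k)" by (rule oddness_ring_graph)
qed

end
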